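(* Let $L$ be a free Lie algebra over $\mathbb{Q}$ with $\dim L/[L,L]>1$, and let $\widehat L=\varprojlim_n L/L^n$ be its completion. Then $H_2(\widehat L)$ is a $\mathbb{Q}$-vector space of uncountable dimension.
   Context: All algebraic structures are over $\mathbb{Q}$, and Lie algebras are ungraded (concentrated in degree $0$). The lower central series of $L$ is $L^1=L$ and $L^n=[L,L^{n-1}]$ for $n>1$. The homology of a Lie algebra $E$ is the ordinary (algebraic, non-continuous) Lie algebra homology with trivial coefficients, $H_*(E)=\mathrm{Tor}^{UE}_*(\mathbb{Q},\mathbb{Q})$, i.e. the homology of the Chevalley–Eilenberg chain complex $(\bigwedge sE,d)$, where $s$ denotes suspension (so $sE$ is in degree $1$). *)

theory Defs
  imports Complex_Main "HOL-Library.Poly_Mapping" "HOL-Library.Countable_Set"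
begin

section \<open>Rational vector spaces\<close>

class rat_vector = ab_group_add +
  fixes scaleQ :: "rat \<Rightarrow> 'a \<Rightarrow> 'a"  (infixr "*\<^sub>Q" 75)
  assumes scaleQ_add_right: "a *\<^sub>Q (x + y) = a *\<^sub>Q x + a *\<^sub>Q y"
    and scaleQ_add_left: "(a + b) *\<^sub>Q x = a *\<^sub>Q x + b *\<^sub>Q x"
    and scaleQ_scaleQ: "a *\<^sub>Q b *\<^sub>Q x = (a * b) *\<^sub>Q x"
    and scaleQ_one: "1 *\<^sub>Q x = x"

global_interpretation rat_vector: vector_space "scaleQ :: rat \<Rightarrow> 'a \<Rightarrow> 'a::rat_vector"
  by unfold_locales (fact scaleQ_add_right scaleQ_add_left scaleQ_scaleQ scaleQ_one)+

abbreviation rat_linear :: "('a::rat_vector \<Rightarrow> 'b::rat_vector) \<Rightarrow> bool" where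
  "rat_linear \<equiv> Vector_Spaces.linear (*\<^sub>Q) (*\<^sub>Q)"

text \<open>The dimension of a subspace \<open>V\<close> is the cardinality of any \<open>B\<close> with \<open>is_basis V B\<close>.
  The library's \<open>dim\<close> is not used, because it is 0 in infinite dimension.\<close>

definition is_basis :: "'a::rat_vector set \<Rightarrow> 'a set \<Rightarrow> bool" where
  "is_basis V B \<longleftrightarrow> \<not> rat_vector.dependent B \<and> rat_vector.span B = V"

instantiation rat :: rat_vector
begin
definition scaleQ_rat :: "rat \<Rightarrow> rat \<Rightarrow> rat" where "scaleQ_rat = (*)"
instance by standard (simp_all add: scaleQ_rat_def algebra_simps)
end

instantiation poly_mapping :: (type, rat_vector) rat_vector
begin
lift_definition scaleQ_poly_mapping :: "rat \<Rightarrow> ('a \<Rightarrow>\<^sub>0 'b) \<Rightarrow> ('a \<Rightarrow>\<^sub>0 'b)"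
  is "\<lambda>c f k. c *\<^sub>Q f k"
  by (rule finite_subset[rotated]) auto
instance
  by standard (transfer; simp add: fun_eq_iff scaleQ_add_right scaleQ_add_left)+
end

definition lin_ext :: "('k \<Rightarrow> 'v::rat_vector) \<Rightarrow> ('k \<Rightarrow>\<^sub>0 rat) \<Rightarrow> 'v" where
  "lin_ext f p = (\<Sum>k\<in>Poly_Mapping.keys p. Poly_Mapping.lookup p k *\<^sub>Q f k)"

lemma lin_ext_superset:
  assumes "finite S" "Poly_Mapping.keys p \<subseteq> S"
  shows "lin_ext f p = (\<Sum>k\<in>S. Poly_Mapping.lookup p k *\<^sub>Q f k)"
  unfolding lin_ext_def
  by (rule sum.mono_neutral_left) (use assms in \<open>auto simp: in_keys_iff\<close>)

lemma lookup_scaleQ: "Poly_Mapping.lookup (c *\<^sub>Q p) k = c *\<^sub>Q Poly_Mapping.lookup p k"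
  by transfer simp

lemma linear_lin_ext: "rat_linear (lin_ext f)"
proof
  fix p q :: "'a \<Rightarrow>\<^sub>0 rat" and c :: rat
  let ?S = "Poly_Mapping.keys p \<union> Poly_Mapping.keys q"
  have "Poly_Mapping.keys (p + q) \<subseteq> ?S" by (rule keys_add)
  then show "lin_ext f (p + q) = lin_ext f p + lin_ext f q"
    by (simp add: lin_ext_superset[of ?S] lookup_add scaleQ_add_left sum.distrib)
  have "Poly_Mapping.keys (c *\<^sub>Q p) \<subseteq> Poly_Mapping.keys p"
    by (auto simp: in_keys_iff lookup_scaleQ)
  then show "lin_ext f (c *\<^sub>Q p) = c *\<^sub>Q lin_ext f p"
    by (simp add: lin_ext_superset[of "Poly_Mapping.keys p"] lookup_scaleQ scaleQ_rat_def
        rat_vector.scale_sum_right)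
qed

lemma lin_ext_single: "lin_ext f (Poly_Mapping.single k c) = c *\<^sub>Q f k"
  by (simp add: lin_ext_def)


section \<open>Lie algebras\<close>

class lie_algebra = rat_vector +
  fixes bracket :: "'a \<Rightarrow> 'a \<Rightarrow> 'a"
  assumes bracket_add_left: "bracket (x + y) z = bracket x z + bracket y z"
    and bracket_add_right: "bracket x (y + z) = bracket x y + bracket x z"
    and bracket_scale_left: "bracket (a *\<^sub>Q x) y = a *\<^sub>Q bracket x y"
    and bracket_scale_right: "bracket x (a *\<^sub>Q y) = a *\<^sub>Q bracket x y"
    and bracket_self: "bracket x x = 0"
    and jacobi: "bracket x (bracket y z) + bracket y (bracket z x) + bracket z (bracket x y) = 0"

definition lie_hom :: "('a::lie_algebra \<Rightarrow> 'b::lie_algebra) \<Rightarrow> bool" where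
  "lie_hom f \<longleftrightarrow> rat_linear f \<and> (\<forall>x y. f (bracket x y) = bracket (f x) (f y))"

definition lie_iso :: "('a::lie_algebra \<Rightarrow> 'b::lie_algebra) \<Rightarrow> bool" where
  "lie_iso f \<longleftrightarrow> lie_hom f \<and> bij f"

text \<open>Lower central series, with the usual numbering from 1; the additional term at index 0
  is again the whole algebra.\<close>

fun lower_central :: "nat \<Rightarrow> 'a::lie_algebra set" where
  "lower_central 0 = UNIV"
| "lower_central (Suc 0) = UNIV"
| "lower_central (Suc (Suc n)) = rat_vector.span {bracket x y | x y. y \<in> lower_central (Suc n)}"

lemma subspace_lower_central: "rat_vector.subspace (lower_central n)"
  by (cases n rule: lower_central.cases) auto

lemmas lower_central_zero = rat_vector.subspace_0[OF subspace_lower_central]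
  and lower_central_add = rat_vector.subspace_add[OF subspace_lower_central]
  and lower_central_neg = rat_vector.subspace_neg[OF subspace_lower_central]
  and lower_central_diff = rat_vector.subspace_diff[OF subspace_lower_central]
  and lower_central_scale = rat_vector.subspace_scale[OF subspace_lower_central]

lemma diff_diff_swap: "(a - b) - (c - d) = (a - c) - (b - d :: 'a::ab_group_add)"
  by simp

lemma bracket_zero_left [simp]: "bracket 0 (x :: 'a::lie_algebra) = 0"
  using bracket_scale_left[of 0 0 x] by simp

lemma bracket_zero_right [simp]: "bracket (x :: 'a::lie_algebra) 0 = 0"
  using bracket_scale_right[of x 0 0] by simp

lemma bracket_minus_left: "bracket (- x) (y :: 'a::lie_algebra) = - bracket x y"
  using bracket_add_left[of x "- x" y] by (simp add: eq_neg_iff_add_eq_0 add.commute)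

lemma bracket_minus_right: "bracket x (- y :: 'a::lie_algebra) = - bracket x y"
  using bracket_add_right[of x y "- y"] by (simp add: eq_neg_iff_add_eq_0 add.commute)

lemma bracket_diff_left: "bracket (x - y) (z :: 'a::lie_algebra) = bracket x z - bracket y z"
  using bracket_add_left[of x "- y" z] by (simp add: bracket_minus_left)

lemma bracket_diff_right: "bracket x (y - z :: 'a::lie_algebra) = bracket x y - bracket x z"
  using bracket_add_right[of x y "- z"] by (simp add: bracket_minus_right)

lemma bracket_antisym: "bracket x y = - bracket y (x :: 'a::lie_algebra)"
  using bracket_self[of "x + y"] bracket_self[of x] bracket_self[of y]
  by (simp add: bracket_add_left bracket_add_right eq_neg_iff_add_eq_0 add.commute)

lemma lower_central_Suc_subset:
  "lower_central (Suc n) \<subseteq> (lower_central n :: 'a::lie_algebra set)"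
proof (induction n)
  case (Suc n)
  show ?case
  proof (cases n)
    case (Suc m)
    then show ?thesis
      using Suc.IH by (simp only: lower_central.simps) (rule rat_vector.span_mono, blast)
  qed auto
qed auto

lemma lower_central_bracket_right:
  assumes "y \<in> lower_central n"
  shows "bracket x y \<in> lower_central n"
proof (cases n rule: lower_central.cases)
  case (3 m)
  then have "y \<in> lower_central (Suc m)" using assms lower_central_Suc_subset by blast
  with 3 show ?thesis by (auto intro: rat_vector.span_base)
qed auto

lemma lower_central_bracket_left:
  "x \<in> lower_central n \<Longrightarrow> bracket x y \<in> lower_central n"
  using lower_central_bracket_right[of x n y]
    lower_central_neg[of "bracket y x" n] bracket_antisym[of x y]
  by simp


section \<open>The abelianization \<open>L/[L,L]\<close>\<close>

definition abelianization_rel :: "'a::lie_algebra \<Rightarrow> 'a \<Rightarrow> bool" where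
  "abelianization_rel x y \<longleftrightarrow> x - y \<in> lower_central 2"

quotient_type (overloaded) 'a abelianization = "'a::lie_algebra" / abelianization_rel
proof (rule equivpI)
  show "reflp (abelianization_rel :: 'a \<Rightarrow> _)"
    by (rule reflpI) (simp add: abelianization_rel_def lower_central_zero)
  show "symp (abelianization_rel :: 'a \<Rightarrow> _)"
    by (rule sympI) (metis abelianization_rel_def lower_central_neg minus_diff_eq)
  show "transp (abelianization_rel :: 'a \<Rightarrow> _)"
    by (rule transpI) (unfold abelianization_rel_def, drule (1) lower_central_add, simp)
qed

instantiation abelianization :: (lie_algebra) rat_vector
begin

lift_definition zero_abelianization :: "'a abelianization" is 0 .

lift_definition plus_abelianization :: "'a abelianization \<Rightarrow> 'a abelianization \<Rightarrow> 'a abelianization"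
  is "(+)"
  unfolding abelianization_rel_def add_diff_add by (rule lower_central_add)

lift_definition uminus_abelianization :: "'a abelianization \<Rightarrow> 'a abelianization" is uminus
  unfolding abelianization_rel_def minus_diff_minus by (rule lower_central_neg)

lift_definition minus_abelianization :: "'a abelianization \<Rightarrow> 'a abelianization \<Rightarrow> 'a abelianization"
  is "(-)"
  unfolding abelianization_rel_def by (subst diff_diff_swap) (rule lower_central_diff)

lift_definition scaleQ_abelianization :: "rat \<Rightarrow> 'a abelianization \<Rightarrow> 'a abelianization" is scaleQ
  unfolding abelianization_rel_def rat_vector.scale_right_diff_distrib[symmetric]
  by (rule lower_central_scale)

instance
  by standard (transfer;
    simp add: abelianization_rel_def algebra_simps scaleQ_add_right scaleQ_add_left scaleQ_one
      lower_central_zero)+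

end


section \<open>The completion \<open>lim L/L^n\<close>\<close>

text \<open>A thread in the inverse limit is given by representatives \<open>f n\<close> of its components in
  \<open>L/L^n\<close>; two coherent sequences of representatives give the same thread iff they agree modulo
  \<open>L^n\<close> for every \<open>n\<close>. See \<open>bij_betw_component\<close> below.\<close>

definition coherent :: "(nat \<Rightarrow> 'a::lie_algebra) \<Rightarrow> bool" where
  "coherent f \<longleftrightarrow> (\<forall>n. f (Suc n) - f n \<in> lower_central n)"

definition completion_rel :: "(nat \<Rightarrow> 'a::lie_algebra) \<Rightarrow> (nat \<Rightarrow> 'a) \<Rightarrow> bool" where
  "completion_rel f g \<longleftrightarrow> coherent f \<and> coherent g \<and> (\<forall>n. f n - g n \<in> lower_central n)"

quotient_type (overloaded) 'a completion = "nat \<Rightarrow> 'a::lie_algebra" / partial: completion_rel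
proof (rule part_equivpI)
  show "\<exists>x :: nat \<Rightarrow> 'a. completion_rel x x"
    by (rule exI[of _ "\<lambda>_. 0"]) (simp add: completion_rel_def coherent_def lower_central_zero)
  show "symp (completion_rel :: (nat \<Rightarrow> 'a) \<Rightarrow> _)"
    by (rule sympI) (metis completion_rel_def lower_central_neg minus_diff_eq)
  show "transp (completion_rel :: (nat \<Rightarrow> 'a) \<Rightarrow> _)"
  proof (rule transpI)
    fix f g h :: "nat \<Rightarrow> 'a"
    assume "completion_rel f g" "completion_rel g h"
    moreover from this have "(f n - g n) + (g n - h n) \<in> lower_central n" for n
      by (intro lower_central_add) (simp_all add: completion_rel_def)
    ultimately show "completion_rel f h" by (simp add: completion_rel_def)
  qed
qed

instantiation completion :: (lie_algebra) lie_algebra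
begin

lift_definition zero_completion :: "'a completion" is "\<lambda>_. 0"
  by (simp add: completion_rel_def coherent_def lower_central_zero)

lift_definition plus_completion :: "'a completion \<Rightarrow> 'a completion \<Rightarrow> 'a completion"
  is "\<lambda>f g n. f n + g n"
  by (auto simp: completion_rel_def coherent_def add_diff_add intro: lower_central_add)

lift_definition uminus_completion :: "'a completion \<Rightarrow> 'a completion" is "\<lambda>f n. - f n"
  unfolding completion_rel_def coherent_def minus_diff_minus by (blast intro: lower_central_neg)

lift_definition minus_completion :: "'a completion \<Rightarrow> 'a completion \<Rightarrow> 'a completion"
  is "\<lambda>f g n. f n - g n"
proof -
  fix f f' g g' :: "nat \<Rightarrow> 'a"
  assume "completion_rel f f'" "completion_rel g g'"
  then show "completion_rel (\<lambda>n. f n - g n) (\<lambda>n. f' n - g' n)"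
    unfolding completion_rel_def coherent_def
      diff_diff_swap[of "f _" "g _"] diff_diff_swap[of "f' _" "g' _"]
    by (blast intro: lower_central_diff)
qed

lift_definition scaleQ_completion :: "rat \<Rightarrow> 'a completion \<Rightarrow> 'a completion" is "\<lambda>c f n. c *\<^sub>Q f n"
  unfolding completion_rel_def coherent_def rat_vector.scale_right_diff_distrib[symmetric]
  by (blast intro: lower_central_scale)

lift_definition bracket_completion :: "'a completion \<Rightarrow> 'a completion \<Rightarrow> 'a completion"
  is "\<lambda>f g n. bracket (f n) (g n)"
proof -
  fix f f' g g' :: "nat \<Rightarrow> 'a"
  have eq: "bracket a b - bracket c d = bracket (a - c) b + bracket c (b - d)" for a b c d :: 'a
    by (simp add: bracket_diff_left bracket_diff_right)
  assume "completion_rel f f'" "completion_rel g g'"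
  then show "completion_rel (\<lambda>n. bracket (f n) (g n)) (\<lambda>n. bracket (f' n) (g' n))"
    unfolding completion_rel_def coherent_def eq
    by (blast intro: lower_central_add lower_central_bracket_left lower_central_bracket_right)
qed

instance
proof -
  have coherentI: "coherent f \<Longrightarrow> coherent g \<Longrightarrow> coherent (\<lambda>n. f n + g n)"
    "coherent f \<Longrightarrow> coherent g \<Longrightarrow> coherent (\<lambda>n. f n - g n)"
    "coherent f \<Longrightarrow> coherent (\<lambda>n. - f n)"
    "coherent f \<Longrightarrow> coherent (\<lambda>n. c *\<^sub>Q f n)"
    "coherent f \<Longrightarrow> coherent g \<Longrightarrow> coherent (\<lambda>n. bracket (f n) (g n))"
    "coherent (\<lambda>n. 0 :: 'a)"
    for f g :: "nat \<Rightarrow> 'a" and c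
  proof -
    have D: "coherent h" if "completion_rel h h'" for h h' :: "nat \<Rightarrow> 'a"
      using that by (simp add: completion_rel_def)
    have R: "completion_rel h h" if "coherent h" for h :: "nat \<Rightarrow> 'a"
      using that by (simp add: completion_rel_def lower_central_zero)
    show "coherent f \<Longrightarrow> coherent g \<Longrightarrow> coherent (\<lambda>n. f n + g n)"
      using plus_completion.rsp by (auto intro!: D dest!: R simp: rel_fun_def)
    show "coherent f \<Longrightarrow> coherent g \<Longrightarrow> coherent (\<lambda>n. f n - g n)"
      using minus_completion.rsp by (auto intro!: D dest!: R simp: rel_fun_def)
    show "coherent f \<Longrightarrow> coherent (\<lambda>n. - f n)"
      using uminus_completion.rsp by (auto intro!: D dest!: R simp: rel_fun_def)
    show "coherent f \<Longrightarrow> coherent (\<lambda>n. c *\<^sub>Q f n)"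
      using scaleQ_completion.rsp by (auto intro!: D dest!: R simp: rel_fun_def)
    show "coherent f \<Longrightarrow> coherent g \<Longrightarrow> coherent (\<lambda>n. bracket (f n) (g n))"
      using bracket_completion.rsp by (auto intro!: D dest!: R simp: rel_fun_def)
    show "coherent (\<lambda>n. 0 :: 'a)"
      by (simp add: coherent_def lower_central_zero)
  qed
  have eqI: "completion_rel h h'" if "coherent h" "h = h'" for h h' :: "nat \<Rightarrow> 'a"
    using that by (simp add: completion_rel_def lower_central_zero)
  have D: "coherent h" if "completion_rel h h'" for h h' :: "nat \<Rightarrow> 'a"
    using that by (simp add: completion_rel_def)
  show "OFCLASS('a completion, lie_algebra_class)"
    by standard (transfer, intro eqI coherentI; (erule D | rule ext,
      rule add.assoc add.commute add_0 left_minus diff_conv_add_uminus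
        scaleQ_add_right scaleQ_add_left scaleQ_scaleQ scaleQ_one bracket_add_left bracket_add_right
        bracket_scale_left bracket_scale_right bracket_self jacobi))+
qed

end

lift_definition component :: "nat \<Rightarrow> 'a::lie_algebra completion \<Rightarrow> 'a set"
  is "\<lambda>n f. {x. x - f n \<in> lower_central n}"
proof -
  fix n and f g :: "nat \<Rightarrow> 'a"
  assume "completion_rel f g"
  then have fg: "f n - g n \<in> lower_central n" by (simp add: completion_rel_def)
  have "x - f n \<in> lower_central n \<longleftrightarrow> x - g n \<in> lower_central n" for x
    using lower_central_add[OF _ fg, of "x - f n"] lower_central_diff[OF _ fg, of "x - g n"] by auto
  then show "{x. x - f n \<in> lower_central n} = {x. x - g n \<in> lower_central n}" by blast
qed

lemma lower_central_class:
  "{(x, y). x - y \<in> lower_central n} `` {a} = {x. x - a \<in> lower_central n}"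
  for a :: "'a::lie_algebra"
proof -
  have "a - x \<in> lower_central n \<longleftrightarrow> x - a \<in> lower_central n" for x
    using lower_central_neg[of "a - x" n] lower_central_neg[of "x - a" n] by auto
  then show ?thesis by auto
qed

lemma bij_betw_component:
  "bij_betw (\<lambda>\<xi> n. component n \<xi>) (UNIV :: 'a::lie_algebra completion set)
    {c. \<forall>n. c n \<in> UNIV // {(x, y). x - y \<in> lower_central n} \<and> c (Suc n) \<subseteq> c n}"
  (is "bij_betw ?comp UNIV {c. ?thread c}")
proof (rule bij_betwI')
  fix \<xi> \<eta> :: "'a completion"
  show "(?comp \<xi> = ?comp \<eta>) = (\<xi> = \<eta>)"
  proof
    assume eq: "?comp \<xi> = ?comp \<eta>"
    have "component n \<xi> = component n \<eta>" for n
      using fun_cong[OF eq, of n] by simp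
    then show "\<xi> = \<eta>"
    proof transfer
      fix f g :: "nat \<Rightarrow> 'a"
      assume fg: "completion_rel f f" "completion_rel g g"
        and *: "\<And>n. {x. x - f n \<in> lower_central n} = {x. x - g n \<in> lower_central n}"
      have "f n - g n \<in> lower_central n" for n
        using *[of n] lower_central_zero[of n] by (metis (lifting) diff_self mem_Collect_eq)
      then show "completion_rel f g" using fg by (simp add: completion_rel_def)
    qed
  qed simp
  show "?comp \<xi> \<in> {c. ?thread c}"
  proof (simp, transfer, safe)
    fix f :: "nat \<Rightarrow> 'a" and n
    assume "completion_rel f f"
    then have f: "f (Suc n) - f n \<in> lower_central n" by (simp add: completion_rel_def coherent_def)
    show "{x. x - f n \<in> lower_central n} \<in> UNIV // {(x, y). x - y \<in> lower_central n}"
      unfolding lower_central_class[symmetric] by (rule quotientI) simp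
    fix x assume "x - f (Suc n) \<in> lower_central (Suc n)"
    then have "x - f (Suc n) \<in> lower_central n" using lower_central_Suc_subset by blast
    from lower_central_add[OF this f] show "x - f n \<in> lower_central n" by simp
  qed
next
  fix c :: "nat \<Rightarrow> 'a set"
  assume c: "c \<in> {c. ?thread c}"
  have "\<exists>a. c n = {x. x - a \<in> lower_central n}" for n
  proof -
    have "c n \<in> UNIV // {(x, y). x - y \<in> lower_central n}" using c by blast
    then show ?thesis by (rule quotientE) (unfold lower_central_class, blast)
  qed
  then obtain f where f: "\<And>n. c n = {x. x - f n \<in> lower_central n}" by metis
  have "coherent f"
    unfolding coherent_def
  proof
    fix n
    have "f (Suc n) \<in> c (Suc n)" by (simp add: f lower_central_zero)
    then have "f (Suc n) \<in> c n" using c by auto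
    then show "f (Suc n) - f n \<in> lower_central n" by (simp add: f)
  qed
  then have "completion_rel f f" by (simp add: completion_rel_def lower_central_zero)
  then have "c = ?comp (abs_completion f)"
    by (simp add: fun_eq_iff f component.abs_eq)
  then show "\<exists>\<xi>\<in>UNIV. c = ?comp \<xi>" by blast
qed


section \<open>Free Lie algebras\<close>

text \<open>Formal Lie algebra expressions in generators from \<open>'x\<close>, modulo the congruence generated by
  the Lie algebra axioms.\<close>

datatype 'x lie_term =
  Gen 'x
| Zero
| Neg "'x lie_term"
| Add "'x lie_term" "'x lie_term"
| Scale rat "'x lie_term"
| Bracket "'x lie_term" "'x lie_term"

inductive lie_eq :: "'x lie_term \<Rightarrow> 'x lie_term \<Rightarrow> bool" (infix "\<approx>" 50) where
  lie_eq_refl: "s \<approx> s"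
| lie_eq_sym: "s \<approx> t \<Longrightarrow> t \<approx> s"
| lie_eq_trans: "s \<approx> t \<Longrightarrow> t \<approx> u \<Longrightarrow> s \<approx> u"
| cong_Neg: "s \<approx> t \<Longrightarrow> Neg s \<approx> Neg t"
| cong_Add: "s \<approx> s' \<Longrightarrow> t \<approx> t' \<Longrightarrow> Add s t \<approx> Add s' t'"
| cong_Scale: "s \<approx> t \<Longrightarrow> Scale a s \<approx> Scale a t"
| cong_Bracket: "s \<approx> s' \<Longrightarrow> t \<approx> t' \<Longrightarrow> Bracket s t \<approx> Bracket s' t'"
| Add_assoc: "Add (Add s t) u \<approx> Add s (Add t u)"
| Add_commute: "Add s t \<approx> Add t s"
| Add_Zero: "Add Zero s \<approx> s"
| Add_Neg: "Add (Neg s) s \<approx> Zero"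
| Scale_Add_right: "Scale a (Add s t) \<approx> Add (Scale a s) (Scale a t)"
| Scale_Add_left: "Scale (a + b) s \<approx> Add (Scale a s) (Scale b s)"
| Scale_Scale: "Scale a (Scale b s) \<approx> Scale (a * b) s"
| Scale_one: "Scale 1 s \<approx> s"
| Bracket_Add_left: "Bracket (Add s t) u \<approx> Add (Bracket s u) (Bracket t u)"
| Bracket_Add_right: "Bracket s (Add t u) \<approx> Add (Bracket s t) (Bracket s u)"
| Bracket_Scale_left: "Bracket (Scale a s) t \<approx> Scale a (Bracket s t)"
| Bracket_Scale_right: "Bracket s (Scale a t) \<approx> Scale a (Bracket s t)"
| Bracket_self: "Bracket s s \<approx> Zero"
| Jacobi: "Add (Add (Bracket s (Bracket t u)) (Bracket t (Bracket u s))) (Bracket u (Bracket s t)) \<approx> Zero"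

quotient_type 'x free_lie = "'x lie_term" / lie_eq
  by (auto intro!: equivpI reflpI sympI transpI intro: lie_eq_refl lie_eq_sym lie_eq_trans)

instantiation free_lie :: (type) lie_algebra
begin

lift_definition zero_free_lie :: "'a free_lie" is Zero .
lift_definition uminus_free_lie :: "'a free_lie \<Rightarrow> 'a free_lie" is Neg by (rule cong_Neg)
lift_definition plus_free_lie :: "'a free_lie \<Rightarrow> 'a free_lie \<Rightarrow> 'a free_lie" is Add by (rule cong_Add)
lift_definition scaleQ_free_lie :: "rat \<Rightarrow> 'a free_lie \<Rightarrow> 'a free_lie" is Scale by (rule cong_Scale)
lift_definition bracket_free_lie :: "'a free_lie \<Rightarrow> 'a free_lie \<Rightarrow> 'a free_lie" is Bracket
  by (rule cong_Bracket)
definition minus_free_lie :: "'a free_lie \<Rightarrow> 'a free_lie \<Rightarrow> 'a free_lie" where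
  "minus_free_lie x y = x + - y"

instance
  by standard
    ((simp add: minus_free_lie_def)?; transfer;
      rule Add_assoc Add_commute Add_Zero Add_Neg Scale_Add_right Scale_Add_left Scale_Scale Scale_one
        Bracket_Add_left Bracket_Add_right Bracket_Scale_left Bracket_Scale_right Bracket_self Jacobi
        lie_eq_refl)+

end

lift_definition free_gen :: "'x \<Rightarrow> 'x free_lie" is Gen .

primrec eval_lie :: "('x \<Rightarrow> 'b::lie_algebra) \<Rightarrow> 'x lie_term \<Rightarrow> 'b" where
  "eval_lie f (Gen x) = f x"
| "eval_lie f Zero = 0"
| "eval_lie f (Neg s) = - eval_lie f s"
| "eval_lie f (Add s t) = eval_lie f s + eval_lie f t"
| "eval_lie f (Scale a s) = a *\<^sub>Q eval_lie f s"
| "eval_lie f (Bracket s t) = bracket (eval_lie f s) (eval_lie f t)"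

lift_definition free_lie_ext :: "('x \<Rightarrow> 'b::lie_algebra) \<Rightarrow> 'x free_lie \<Rightarrow> 'b" is eval_lie
proof -
  fix f :: "'x \<Rightarrow> 'b" and s t :: "'x lie_term"
  assume "s \<approx> t"
  then show "eval_lie f s = eval_lie f t"
    by induction (simp_all add: algebra_simps scaleQ_add_right scaleQ_add_left scaleQ_one
        bracket_add_left bracket_add_right bracket_scale_left bracket_scale_right bracket_self
        jacobi[simplified add.assoc])
qed

lemma free_lie_universal:
  fixes f :: "'x \<Rightarrow> 'b::lie_algebra"
  shows "\<exists>!h. lie_hom h \<and> (\<forall>x. h (free_gen x) = f x)"
proof (rule ex1I)
  have "rat_linear (free_lie_ext f)"
    by standard (transfer; simp)+
  moreover have "free_lie_ext f (bracket s t) = bracket (free_lie_ext f s) (free_lie_ext f t)" for s t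
    by transfer simp
  moreover have "free_lie_ext f (free_gen x) = f x" for x
    by (simp add: free_gen.abs_eq free_lie_ext.abs_eq)
  ultimately show "lie_hom (free_lie_ext f) \<and> (\<forall>x. free_lie_ext f (free_gen x) = f x)"
    by (simp add: lie_hom_def)
next
  fix h :: "'x free_lie \<Rightarrow> 'b"
  assume h: "lie_hom h \<and> (\<forall>x. h (free_gen x) = f x)"
  interpret h: Vector_Spaces.linear "(*\<^sub>Q)" "(*\<^sub>Q)" h using h by (simp add: lie_hom_def)
  have "h (abs_free_lie s) = eval_lie f s" for s
  proof (induction s)
    case (Gen x) then show ?case using h by (simp add: free_gen.abs_eq)
  next
    case Zero then show ?case by (simp flip: zero_free_lie_def)
  next
    case (Neg s) then show ?case by (simp flip: uminus_free_lie.abs_eq add: h.neg)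
  next
    case (Add s t) then show ?case by (simp flip: plus_free_lie.abs_eq add: h.add)
  next
    case (Scale a s) then show ?case by (simp flip: scaleQ_free_lie.abs_eq add: h.scale)
  next
    case (Bracket s t) then show ?case using h by (simp flip: bracket_free_lie.abs_eq add: lie_hom_def)
  qed
  then show "h = free_lie_ext f"
    by (metis free_lie_ext.abs_eq Quotient_free_lie Quotient_abs_rep ext)
qed

no_notation lie_eq (infix "\<approx>" 50)


section \<open>Chevalley--Eilenberg homology\<close>

abbreviation word :: "'a list \<Rightarrow> ('a list \<Rightarrow>\<^sub>0 rat)" where
  "word xs \<equiv> Poly_Mapping.single xs 1"

text \<open>The exterior algebra is the free vector space on words, modulo multilinearity and
  \<open>x \<and> x = 0\<close>; that is, the tensor algebra modulo the two-sided ideal generated by all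
  \<open>x \<otimes> x\<close>.\<close>

definition exterior_relators :: "('a::rat_vector list \<Rightarrow>\<^sub>0 rat) set" where
  "exterior_relators =
    {word (us @ (x + y) # vs) - word (us @ x # vs) - word (us @ y # vs) | us x y vs. True} \<union>
    {word (us @ (c *\<^sub>Q x) # vs) - c *\<^sub>Q word (us @ x # vs) | us c x vs. True} \<union>
    {word (us @ x # x # vs) | us x vs. True}"

definition exterior_rel :: "('a::rat_vector list \<Rightarrow>\<^sub>0 rat) \<Rightarrow> ('a list \<Rightarrow>\<^sub>0 rat) \<Rightarrow> bool" where
  "exterior_rel p q \<longleftrightarrow> p - q \<in> rat_vector.span exterior_relators"

quotient_type (overloaded) 'a exterior = "'a::rat_vector list \<Rightarrow>\<^sub>0 rat" / exterior_rel
proof (rule equivpI)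
  show "reflp (exterior_rel :: ('a list \<Rightarrow>\<^sub>0 rat) \<Rightarrow> _)"
    by (rule reflpI) (simp add: exterior_rel_def rat_vector.span_zero)
  show "symp (exterior_rel :: ('a list \<Rightarrow>\<^sub>0 rat) \<Rightarrow> _)"
    by (rule sympI) (metis exterior_rel_def rat_vector.span_neg minus_diff_eq)
  show "transp (exterior_rel :: ('a list \<Rightarrow>\<^sub>0 rat) \<Rightarrow> _)"
    by (rule transpI) (unfold exterior_rel_def, drule (1) rat_vector.span_add, simp)
qed

instantiation exterior :: (rat_vector) rat_vector
begin

lift_definition zero_exterior :: "'a exterior" is 0 .

lift_definition plus_exterior :: "'a exterior \<Rightarrow> 'a exterior \<Rightarrow> 'a exterior" is "(+)"
  unfolding exterior_rel_def add_diff_add by (rule rat_vector.span_add)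

lift_definition uminus_exterior :: "'a exterior \<Rightarrow> 'a exterior" is uminus
  unfolding exterior_rel_def minus_diff_minus by (rule rat_vector.span_neg)

lift_definition minus_exterior :: "'a exterior \<Rightarrow> 'a exterior \<Rightarrow> 'a exterior" is "(-)"
  unfolding exterior_rel_def by (subst diff_diff_swap) (rule rat_vector.span_diff)

lift_definition scaleQ_exterior :: "rat \<Rightarrow> 'a exterior \<Rightarrow> 'a exterior" is scaleQ
  unfolding exterior_rel_def rat_vector.scale_right_diff_distrib[symmetric]
  by (rule rat_vector.span_scale)

instance
  by standard (transfer;
    simp add: exterior_rel_def algebra_simps scaleQ_add_right scaleQ_add_left scaleQ_one
      rat_vector.span_zero)+

end

lift_definition wedge :: "'a::rat_vector list \<Rightarrow> 'a exterior" is word .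

definition exterior_power :: "nat \<Rightarrow> 'a::rat_vector exterior set" where
  "exterior_power n = rat_vector.span {wedge xs | xs. length xs = n}"

text \<open>Indices start at 0 here; the parity of \<open>i + j\<close>, hence the sign, is the same as with indices
  starting at 1.\<close>

definition ce_word :: "'a::lie_algebra list \<Rightarrow> ('a list \<Rightarrow>\<^sub>0 rat)" where
  "ce_word xs = (\<Sum>(i, j)\<in>{(i, j). i < j \<and> j < length xs}.
     (-1) ^ (i + j) *\<^sub>Q word (bracket (xs ! i) (xs ! j) # nths xs (- {i, j})))"

definition ce_summand :: "'a::lie_algebra list \<Rightarrow> nat \<times> nat \<Rightarrow> ('a list \<Rightarrow>\<^sub>0 rat)" where
  "ce_summand xs = (\<lambda>(i, j). word (bracket (xs ! i) (xs ! j) # nths xs (- {i, j})))"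

definition ce_pairs :: "nat \<Rightarrow> (nat \<times> nat) set" where
  "ce_pairs n = {(i, j). i < j \<and> j < n}"

definition ce_sign :: "nat \<times> nat \<Rightarrow> rat" where
  "ce_sign = (\<lambda>(i, j). (-1) ^ (i + j))"

lemma ce_word_alt: "ce_word xs = (\<Sum>q\<in>ce_pairs (length xs). ce_sign q *\<^sub>Q ce_summand xs q)"
  by (simp add: ce_word_def ce_pairs_def ce_sign_def ce_summand_def case_prod_unfold)

lemma finite_ce_pairs: "finite (ce_pairs n)"
  by (rule finite_subset[of _ "{..<n} \<times> {..<n}"]) (auto simp: ce_pairs_def)

lemma nths_middle:
  "nths (us @ z # vs) A =
    nths us A @ (if length us \<in> A then [z] else []) @ nths vs {k. Suc (k + length us) \<in> A}"
  by (simp add: nths_append nths_Cons)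

lemma nths_double:
  "nths (us @ x # x # vs) A =
    nths us A @ (if length us \<in> A then [x] else []) @ (if Suc (length us) \<in> A then [x] else []) @
    nths vs {k. Suc (Suc (k + length us)) \<in> A}"
  by (simp add: nths_append nths_Cons)

lemma relator_add:
  "word (us @ (x + y) # vs) - word (us @ x # vs) - word (us @ y # vs)
    \<in> rat_vector.span exterior_relators"
  by (rule rat_vector.span_base) (unfold exterior_relators_def, blast)

lemma relator_scale:
  "word (us @ (c *\<^sub>Q x) # vs) - c *\<^sub>Q word (us @ x # vs) \<in> rat_vector.span exterior_relators"
  by (rule rat_vector.span_base) (unfold exterior_relators_def, blast)

lemma relator_self: "word (us @ x # x # vs) \<in> rat_vector.span exterior_relators"
  by (rule rat_vector.span_base) (unfold exterior_relators_def, blast)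

lemma relator_zero: "word (0 # vs) \<in> rat_vector.span exterior_relators"
  using relator_scale[of "[]" 0 0 vs] by simp

lemma ce_summand_middle:
  fixes us vs :: "'a::lie_algebra list"
  assumes "i < j"
  obtains (head) g t where "\<And>z. ce_summand (us @ z # vs) (i, j) = word (g z # t)"
      "\<And>x y. g (x + y) = g x + g y" "\<And>c x. g (c *\<^sub>Q x) = c *\<^sub>Q g x"
    | (tail) us' vs' where "\<And>z. ce_summand (us @ z # vs) (i, j) = word (us' @ z # vs')"
proof -
  let ?p = "length us"
  define u where "u k = (us @ 0 # vs) ! k" for k
  have const: "(us @ z # vs) ! k = u k" if "k \<noteq> ?p" for k z
    using that by (auto simp: u_def nth_append nth_Cons split: nat.split)
  consider "i = ?p" | "j = ?p" | "i \<noteq> ?p" "j \<noteq> ?p" by blast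
  then show thesis
  proof cases
    case 1
    then have j: "j \<noteq> ?p" using assms by simp
    show thesis
      by (rule head[of "\<lambda>z. bracket z (u j)"
            "nths us (- {i, j}) @ nths vs {k. Suc (k + ?p) \<in> - {i, j}}"])
        (use 1 in \<open>simp_all add: ce_summand_def nths_middle const[OF j] bracket_add_left
          bracket_scale_left\<close>)
  next
    case 2
    then have i: "i \<noteq> ?p" using assms by simp
    show thesis
      by (rule head[of "\<lambda>z. bracket (u i) z"
            "nths us (- {i, j}) @ nths vs {k. Suc (k + ?p) \<in> - {i, j}}"])
        (use 2 in \<open>simp_all add: ce_summand_def nths_middle const[OF i] bracket_add_right
          bracket_scale_right\<close>)
  next
    case 3
    show thesis
      by (rule tail[of "bracket (u i) (u j) # nths us (- {i, j})"
            "nths vs {k. Suc (k + ?p) \<in> - {i, j}}"])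
        (use 3 in \<open>simp add: ce_summand_def nths_middle const[OF 3(1)] const[OF 3(2)]\<close>)
  qed
qed

lemma ce_word_add:
  "ce_word (us @ (x + y) # vs) - ce_word (us @ x # vs) - ce_word (us @ y # vs)
    \<in> rat_vector.span exterior_relators"
proof -
  have "ce_summand (us @ (x + y) # vs) q - ce_summand (us @ x # vs) q - ce_summand (us @ y # vs) q
      \<in> rat_vector.span exterior_relators" if q: "q \<in> ce_pairs n" for q n
  proof -
    obtain i j where ij: "q = (i, j)" "i < j" using q by (auto simp: ce_pairs_def)
    from ij(2) show ?thesis
    proof (cases rule: ce_summand_middle[of i j us vs])
      case (head g t)
      then show ?thesis using relator_add[of "[]" "g x" "g y" t] by (simp add: ij(1))
    next
      case (tail us' vs')
      then show ?thesis using relator_add[of us' x y vs'] by (simp add: ij(1))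
    qed
  qed
  then show ?thesis
    unfolding ce_word_alt
    by (auto simp flip: sum_subtractf rat_vector.scale_right_diff_distrib
        intro!: rat_vector.span_sum rat_vector.span_scale)
qed

lemma ce_word_scale:
  "ce_word (us @ (c *\<^sub>Q x) # vs) - c *\<^sub>Q ce_word (us @ x # vs)
    \<in> rat_vector.span exterior_relators"
proof -
  have "ce_summand (us @ (c *\<^sub>Q x) # vs) q - c *\<^sub>Q ce_summand (us @ x # vs) q
      \<in> rat_vector.span exterior_relators" if q: "q \<in> ce_pairs n" for q n
  proof -
    obtain i j where ij: "q = (i, j)" "i < j" using q by (auto simp: ce_pairs_def)
    from ij(2) show ?thesis
    proof (cases rule: ce_summand_middle[of i j us vs])
      case (head g t)
      then show ?thesis using relator_scale[of "[]" c "g x" t] by (simp add: ij(1))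
    next
      case (tail us' vs')
      then show ?thesis using relator_scale[of us' c x vs'] by (simp add: ij(1))
    qed
  qed
  moreover have "ce_word (us @ (c *\<^sub>Q x) # vs) - c *\<^sub>Q ce_word (us @ x # vs) =
    (\<Sum>q\<in>ce_pairs (length (us @ x # vs)). ce_sign q *\<^sub>Q
      (ce_summand (us @ (c *\<^sub>Q x) # vs) q - c *\<^sub>Q ce_summand (us @ x # vs) q))"
    by (simp add: ce_word_alt rat_vector.scale_sum_right rat_vector.scale_right_diff_distrib
        sum_subtractf mult.commute)
  ultimately show ?thesis
    by (auto intro!: rat_vector.span_sum rat_vector.span_scale)
qed

lemma ce_word_self:
  fixes x :: "'a::lie_algebra"
  shows "ce_word (us @ x # x # vs) \<in> rat_vector.span exterior_relators"
proof -
  let ?p = "length us" and ?w = "us @ x # x # vs"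
  let ?S = "ce_pairs (length ?w)"
  let ?F = "\<lambda>q. ce_sign q *\<^sub>Q ce_summand ?w q"
  define A where "A = {(i, j) \<in> ?S. (i = ?p \<or> j = ?p) \<and> i \<noteq> Suc ?p \<and> j \<noteq> Suc ?p}"
  define B where "B = {(i, j) \<in> ?S. (i = Suc ?p \<or> j = Suc ?p) \<and> i \<noteq> ?p \<and> j \<noteq> ?p}"
  define C where "C = ?S - A - B"
  define \<tau> where "\<tau> k = (if k = ?p then Suc ?p else k)" for k
  have fin: "finite ?S" by (rule finite_ce_pairs)
  have sub: "A \<subseteq> ?S" "B \<subseteq> ?S" "A \<inter> B = {}" by (auto simp: A_def B_def)
  have inj: "inj_on (map_prod \<tau> \<tau>) A"
    by (auto simp: inj_on_def A_def \<tau>_def split: if_splits)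
  have B: "B = map_prod \<tau> \<tau> ` A"
  proof (rule set_eqI)
    fix q :: "nat \<times> nat"
    obtain i j where q: "q = (i, j)" by (cases q)
    have "q \<in> map_prod \<tau> \<tau> ` A" if "q \<in> B"
    proof (rule image_eqI)
      define \<sigma> where "\<sigma> k = (if k = Suc ?p then ?p else k)" for k
      show "map_prod \<sigma> \<sigma> q \<in> A"
        using that q by (auto simp: A_def B_def \<sigma>_def ce_pairs_def split: if_splits)
      show "q = map_prod \<tau> \<tau> (map_prod \<sigma> \<sigma> q)"
        using that q by (auto simp: B_def \<sigma>_def \<tau>_def)
    qed
    moreover have "q \<in> B" if "q \<in> map_prod \<tau> \<tau> ` A"
      using that q by (auto simp: A_def B_def \<tau>_def ce_pairs_def split: if_splits)
    ultimately show "q \<in> B \<longleftrightarrow> q \<in> map_prod \<tau> \<tau> ` A" by blast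
  qed
  have opposite: "?F (map_prod \<tau> \<tau> q) = - ?F q" if "q \<in> A" for q
  proof -
    obtain i j where q: "q = (i, j)" "i < j"
      using \<open>q \<in> A\<close> by (cases q) (auto simp: A_def ce_pairs_def)
    have nth: "?w ! \<tau> k = ?w ! k" for k by (simp add: \<tau>_def nth_append)
    have sign: "ce_sign (map_prod \<tau> \<tau> q) = - ce_sign q"
      using that q by (auto simp: A_def ce_sign_def \<tau>_def)
    have rest: "nths ?w (- {\<tau> i, \<tau> j}) = nths ?w (- {i, j})"
    proof -
      have "nths us (- {\<tau> i, \<tau> j}) = nths us (- {i, j})"
      proof -
        have "nths us X = nths us Y" if "\<And>k. k < ?p \<Longrightarrow> k \<in> X \<longleftrightarrow> k \<in> Y" for X Y
          unfolding nths_def using that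
          by (intro arg_cong[where f = "map fst"] filter_cong) (auto dest: set_zip_rightD)
        then show ?thesis by (auto simp: \<tau>_def)
      qed
      moreover have "{k. Suc (Suc (k + ?p)) \<in> - {\<tau> i, \<tau> j}} = {k. Suc (Suc (k + ?p)) \<in> - {i, j}}"
        by (auto simp: \<tau>_def)
      moreover have "?p \<in> - {\<tau> i, \<tau> j}" "Suc ?p \<notin> - {\<tau> i, \<tau> j}" "?p \<notin> - {i, j}" "Suc ?p \<in> - {i, j}"
        using \<open>q \<in> A\<close> q by (auto simp: A_def \<tau>_def)
      ultimately show ?thesis
        by (simp only: nths_double if_True if_False append_Nil)
    qed
    have "ce_summand ?w (map_prod \<tau> \<tau> q) = ce_summand ?w q"
      using q by (simp add: ce_summand_def nth rest)
    then show ?thesis by (simp add: sign)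
  qed
  have "sum ?F B = - sum ?F A"
    unfolding B sum.reindex[OF inj] by (simp add: opposite sum_negf)
  moreover have "sum ?F ?S = sum ?F C + (sum ?F B + sum ?F A)"
  proof -
    have "sum ?F ?S = sum ?F (?S - A) + sum ?F A"
      using fin sub by (intro sum.subset_diff)
    also have "sum ?F (?S - A) = sum ?F C + sum ?F B"
      unfolding C_def using fin sub by (intro sum.subset_diff) auto
    finally show ?thesis by (simp add: add.assoc)
  qed
  ultimately have eq: "ce_word ?w = sum ?F C" by (simp add: ce_word_alt)
  have "ce_summand ?w q \<in> rat_vector.span exterior_relators" if "q \<in> C" for q
  proof -
    obtain i j where q: "q = (i, j)" "i < j" "j < length ?w"
      using \<open>q \<in> C\<close> by (cases q) (auto simp: C_def ce_pairs_def)
    have "(i, j) \<in> ?S" "(i, j) \<notin> A" "(i, j) \<notin> B"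
      using \<open>q \<in> C\<close> q(1) by (simp_all add: C_def)
    then have "i = ?p \<and> j = Suc ?p \<or> i \<notin> {?p, Suc ?p} \<and> j \<notin> {?p, Suc ?p}"
      using q(2) by (auto simp: A_def B_def)
    then consider "i = ?p" "j = Suc ?p" | "i \<notin> {?p, Suc ?p}" "j \<notin> {?p, Suc ?p}"
      by blast
    then show ?thesis
    proof cases
      case 1
      then show ?thesis
        by (simp add: q ce_summand_def nth_append bracket_self relator_zero)
    next
      case 2
      then have "nths ?w (- {i, j}) = nths us (- {i, j}) @ x # x #
          nths vs {k. Suc (Suc (k + ?p)) \<in> - {i, j}}"
        by (simp add: nths_double)
      then show ?thesis
        using relator_self[of "bracket (?w ! i) (?w ! j) # nths us (- {i, j})" x]
        by (simp add: q ce_summand_def)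
    qed
  qed
  then show ?thesis
    unfolding eq by (auto intro!: rat_vector.span_sum rat_vector.span_scale)
qed

lift_definition ce_diff :: "'a::lie_algebra exterior \<Rightarrow> 'a exterior" is "lin_ext ce_word"
proof -
  let ?R = "rat_vector.span exterior_relators :: ('a list \<Rightarrow>\<^sub>0 rat) set"
  interpret L: Vector_Spaces.linear "(*\<^sub>Q)" "(*\<^sub>Q)" "lin_ext (ce_word :: 'a list \<Rightarrow> _)"
    by (rule linear_lin_ext)
  have base: "lin_ext ce_word r \<in> ?R" if "r \<in> exterior_relators" for r
  proof -
    from that consider (add) us x y vs where
        "r = word (us @ (x + y) # vs) - word (us @ x # vs) - word (us @ y # vs)"
      | (scale) us c x vs where "r = word (us @ (c *\<^sub>Q x) # vs) - c *\<^sub>Q word (us @ x # vs)"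
      | (self) us x vs where "r = word (us @ x # x # vs)"
      unfolding exterior_relators_def by blast
    then show ?thesis
      by cases (simp_all add: L.diff L.scale lin_ext_single scaleQ_one
        ce_word_add ce_word_scale ce_word_self)
  qed
  have "lin_ext ce_word r \<in> ?R" if "r \<in> ?R" for r
    using that
  proof (rule rat_vector.span_induct)
    show "rat_vector.subspace {r. lin_ext ce_word r \<in> ?R}"
      by (rule L.subspace_vimage[unfolded vimage_def]) (rule rat_vector.subspace_span)
  qed (rule base)
  then show "exterior_rel (lin_ext ce_word p) (lin_ext ce_word q)" if "exterior_rel p q"
    for p q :: "'a list \<Rightarrow>\<^sub>0 rat"
    using that by (simp add: exterior_rel_def flip: L.diff)
qed

lemma linear_ce_diff: "rat_linear (ce_diff :: 'a::lie_algebra exterior \<Rightarrow> 'a exterior)"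
proof -
  interpret L: Vector_Spaces.linear "(*\<^sub>Q)" "(*\<^sub>Q)" "lin_ext (ce_word :: 'a list \<Rightarrow> _)"
    by (rule linear_lin_ext)
  show ?thesis
    by standard (transfer; simp add: L.add L.scale exterior_rel_def rat_vector.span_zero)+
qed

definition ce_homologous :: "'a::lie_algebra exterior \<Rightarrow> 'a exterior \<Rightarrow> bool" where
  "ce_homologous x y \<longleftrightarrow> ce_diff x = 0 \<and> ce_diff y = 0 \<and> x - y \<in> range ce_diff"

lemma subspace_ce_boundaries: "rat_vector.subspace (range (ce_diff :: 'a::lie_algebra exterior \<Rightarrow> _))"
proof -
  interpret d: Vector_Spaces.linear "(*\<^sub>Q)" "(*\<^sub>Q)" "ce_diff :: 'a exterior \<Rightarrow> _"
    by (rule linear_ce_diff)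
  show ?thesis by (rule d.subspace_image) (rule rat_vector.subspace_UNIV)
qed

lemmas ce_boundary_zero = rat_vector.subspace_0[OF subspace_ce_boundaries]
  and ce_boundary_add = rat_vector.subspace_add[OF subspace_ce_boundaries]
  and ce_boundary_neg = rat_vector.subspace_neg[OF subspace_ce_boundaries]
  and ce_boundary_diff = rat_vector.subspace_diff[OF subspace_ce_boundaries]
  and ce_boundary_scale = rat_vector.subspace_scale[OF subspace_ce_boundaries]

lemma ce_diff_simps:
  "ce_diff (0 :: 'a::lie_algebra exterior) = 0"
  "ce_diff (x + y) = ce_diff x + ce_diff (y :: 'a exterior)"
  "ce_diff (- x) = - ce_diff x"
  "ce_diff (x - y) = ce_diff x - ce_diff y"
  "ce_diff (c *\<^sub>Q x) = c *\<^sub>Q ce_diff x"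
proof -
  interpret d: Vector_Spaces.linear "(*\<^sub>Q)" "(*\<^sub>Q)" "ce_diff :: 'a exterior \<Rightarrow> _"
    by (rule linear_ce_diff)
  show "ce_diff (0 :: 'a exterior) = 0" "ce_diff (x + y) = ce_diff x + ce_diff y"
    "ce_diff (- x) = - ce_diff x" "ce_diff (x - y) = ce_diff x - ce_diff y"
    "ce_diff (c *\<^sub>Q x) = c *\<^sub>Q ce_diff x"
    by (rule d.zero d.add d.neg d.diff d.scale)+
qed

lemma ce_diff_wedge:
  "ce_diff (wedge xs) = (\<Sum>(i, j)\<in>{(i, j). i < j \<and> j < length xs}.
     (-1) ^ (i + j) *\<^sub>Q wedge (bracket (xs ! i) (xs ! j) # nths xs (- {i, j})))"
proof -
  have sum: "abs_exterior (sum f A) = (\<Sum>a\<in>A. abs_exterior (f a))"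
    for f :: "nat \<times> nat \<Rightarrow> 'a list \<Rightarrow>\<^sub>0 rat" and A
    by (induction A rule: infinite_finite_induct)
      (simp_all flip: plus_exterior.abs_eq zero_exterior_def)
  show ?thesis
    by (simp add: wedge.abs_eq ce_diff.abs_eq lin_ext_single scaleQ_one ce_word_def sum
        scaleQ_exterior.abs_eq case_prod_unfold)
qed

quotient_type (overloaded) 'a ce_homology = "'a::lie_algebra exterior" / partial: ce_homologous
proof (rule part_equivpI)
  show "\<exists>x :: 'a exterior. ce_homologous x x"
    by (rule exI[of _ 0]) (simp add: ce_homologous_def ce_boundary_zero ce_diff_simps)
  show "symp (ce_homologous :: 'a exterior \<Rightarrow> _)"
    by (rule sympI) (metis ce_homologous_def ce_boundary_neg minus_diff_eq)
  show "transp (ce_homologous :: 'a exterior \<Rightarrow> _)"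
  proof (rule transpI)
    fix x y z :: "'a exterior"
    assume "ce_homologous x y" "ce_homologous y z"
    moreover from this have "(x - y) + (y - z) \<in> range ce_diff"
      by (intro ce_boundary_add) (simp_all add: ce_homologous_def)
    ultimately show "ce_homologous x z" by (simp add: ce_homologous_def)
  qed
qed

instantiation ce_homology :: (lie_algebra) rat_vector
begin

lift_definition zero_ce_homology :: "'a ce_homology" is 0
  by (simp add: ce_homologous_def ce_boundary_zero ce_diff_simps)

lift_definition plus_ce_homology :: "'a ce_homology \<Rightarrow> 'a ce_homology \<Rightarrow> 'a ce_homology" is "(+)"
  unfolding ce_homologous_def add_diff_add by (auto simp: ce_diff_simps intro: ce_boundary_add)

lift_definition uminus_ce_homology :: "'a ce_homology \<Rightarrow> 'a ce_homology" is uminus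
  unfolding ce_homologous_def minus_diff_minus ce_diff_simps neg_equal_0_iff_equal
  by (blast intro: ce_boundary_neg)

lift_definition minus_ce_homology :: "'a ce_homology \<Rightarrow> 'a ce_homology \<Rightarrow> 'a ce_homology" is "(-)"
  unfolding ce_homologous_def by (subst diff_diff_swap) (simp add: ce_diff_simps ce_boundary_diff)

lift_definition scaleQ_ce_homology :: "rat \<Rightarrow> 'a ce_homology \<Rightarrow> 'a ce_homology" is scaleQ
  unfolding ce_homologous_def rat_vector.scale_right_diff_distrib[symmetric]
  by (simp add: ce_diff_simps ce_boundary_scale)

instance
  by standard (transfer;
    simp add: ce_homologous_def ce_diff_simps algebra_simps scaleQ_add_right scaleQ_add_left
      scaleQ_one ce_boundary_zero)+

end

definition ce_homology_degree :: "nat \<Rightarrow> 'a::lie_algebra ce_homology set" where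
  "ce_homology_degree n = abs_ce_homology ` {z \<in> exterior_power n. ce_diff z = 0}"

end

theory Submission
  imports Defs "HOL-Computational_Algebra.Fraction_Field"
    "HOL-Computational_Algebra.Formal_Laurent_Series"
    "HOL-Computational_Algebra.Polynomial_FPS"
begin

text \<open>Let \<open>x\<close>, \<open>y\<close> be two free generators, \<open>y i = ad x ^ i y\<close>, and
  \<open>H k = (\<Sum>i<k. (-1) ^ i [y i, y (2k - 1 - i)])\<close>, so that \<open>[x, H k] = [y, y (2k)]\<close>. For every
  rational sequence \<open>c\<close> the element
  \<open>y \<and> (\<Sum>k. c k y (2k)) - x \<and> (\<Sum>k. c k H k)\<close> is therefore a 2-cycle of the completion.
  Mapping \<open>x\<close> to the generator of \<open>\<rat>\<close> and \<open>y\<close> to 1 sends the completion to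
  \<open>\<rat>[[t]] \<rtimes> \<rat>\<close>, where \<open>\<rat>\<close> acts through multiplication by \<open>t\<close>; the cycle goes to
  \<open>1 \<and> g\<close> with \<open>g = (\<Sum>k. c k t ^ (2k))\<close>. A \<open>\<rat>(t)\<close>-linear endomorphism \<open>f\<close> of
  \<open>\<rat>((t))\<close> gives the cocycle \<open>m, n \<mapsto>\<close> constant term of \<open>m(-t) f(n) - n(-t) f(m)\<close>, and
  choosing \<open>f\<close> with \<open>f 1 = 0\<close> separates two cycles unless the difference of their \<open>g\<close> lies
  in the countable set \<open>\<rat>(t)\<close>. So the homology is uncountable already as a set, which over
  \<open>\<rat>\<close> means uncountable dimension.\<close>

section \<open>Countable spans\<close>

lemma rat_linearD:
  assumes "rat_linear f"
  shows "f (x + y) = f x + f y" "f (x - y) = f x - f y" "f (- x) = - f x" "f 0 = 0"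
    "f (c *\<^sub>Q x) = c *\<^sub>Q f x" "f (sum g A) = (\<Sum>a\<in>A. f (g a))"
proof -
  interpret f: Vector_Spaces.linear "(*\<^sub>Q)" "(*\<^sub>Q)" f by fact
  show "f (x + y) = f x + f y" "f (x - y) = f x - f y" "f (- x) = - f x" "f 0 = 0"
    "f (c *\<^sub>Q x) = c *\<^sub>Q f x" "f (sum g A) = (\<Sum>a\<in>A. f (g a))"
    by (rule f.add f.diff f.neg f.zero f.scale f.sum)+
qed

lemma rat_linearI:
  assumes "\<And>x y. f (x + y) = f x + f y" "\<And>c x. f (c *\<^sub>Q x) = c *\<^sub>Q f x"
  shows "rat_linear f"
  by standard (fact assms)+

text \<open>An element of the span is the value of a finite list of pairs from Q x \<open>B\<close>,
  and there are only countably many such lists.\<close>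

lemma countable_span:
  fixes B :: "'a::rat_vector set"
  assumes "countable B"
  shows "countable (rat_vector.span B)"
proof -
  let ?e = "\<lambda>xs. \<Sum>(c, b)\<leftarrow>xs. c *\<^sub>Q b"
  let ?L = "lists ((UNIV :: rat set) \<times> B)"
  have "x \<in> ?e ` ?L" if "x \<in> rat_vector.span B" for x
    using that
  proof (induction rule: rat_vector.span_induct_alt)
    case base
    show ?case by (rule image_eqI[of _ _ "[]"]) auto
  next
    case (step c x y)
    then obtain xs where "xs \<in> ?L" "y = ?e xs" by blast
    with step(1) show ?case by (intro image_eqI[of _ _ "(c, x) # xs"]) auto
  qed
  moreover have "countable (?e ` ?L)"
    using assms by (intro countable_image countable_lists countable_SIGMA) auto
  ultimately show ?thesis by (meson countable_subset subsetI)
qed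

text \<open>Turns cardinality into dimension: a countable basis would have a countable span.\<close>

lemma uncountable_basis_if_uncountable:
  fixes V :: "'a::rat_vector set"
  assumes "rat_vector.subspace V" "uncountable V"
  shows "\<exists>B. is_basis V B \<and> uncountable B"
proof -
  obtain B where B: "B \<subseteq> V" "\<not> rat_vector.dependent B" "V \<subseteq> rat_vector.span B"
    using rat_vector.maximal_independent_subset .
  then have "rat_vector.span B = V"
    using rat_vector.span_minimal[OF B(1) assms(1)] by blast
  moreover from this have "uncountable B" using countable_span assms(2) by blast
  ultimately show ?thesis using B(2) by (auto simp: is_basis_def)
qed

lemma uncountable_rat_sequences: "uncountable (UNIV :: (nat \<Rightarrow> rat) set)"
proof
  assume "countable (UNIV :: (nat \<Rightarrow> rat) set)"
  then obtain f :: "nat \<Rightarrow> nat \<Rightarrow> rat" where f: "range f = UNIV"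
    by (metis UNIV_not_empty uncountable_def)
  \<comment> \<open>Cantor's diagonal: this sequence differs from each \<open>f n\<close> at index
    \<open>n\<close>.\<close>
  then obtain n where "f n = (\<lambda>n. f n n + 1)" by (metis UNIV_I imageE)
  then have "f n n = f n n + 1" by metis
  then show False by simp
qed


section \<open>Rational functions inside Laurent series\<close>

text \<open>The embedding of Q(t) into Q((t)), which expands a quotient at 0. It divides some chosen
  representing pair; \<open>fls_of_fract_Fract\<close> shows that the choice does not
  matter.\<close>

definition fls_of_fract :: "rat poly fract \<Rightarrow> rat fls" where
  "fls_of_fract q = (case SOME (a, b). b \<noteq> 0 \<and> q = Fract a b of
     (a, b) \<Rightarrow> fps_to_fls (fps_of_poly a) / fps_to_fls (fps_of_poly b))"

lemma fps_of_poly_eq_0_iff: "fps_of_poly p = 0 \<longleftrightarrow> p = 0"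
  using fps_of_poly_eq_iff[of p 0] by simp

lemma fls_of_fract_Fract:
  assumes "b \<noteq> 0"
  shows "fls_of_fract (Fract a b) = fps_to_fls (fps_of_poly a) / fps_to_fls (fps_of_poly b)"
proof -
  let ?P = "\<lambda>(c, d). d \<noteq> 0 \<and> Fract a b = Fract c d"
  obtain c d where s: "(SOME p. ?P p) = (c, d)" by (cases "SOME p. ?P p")
  have "?P (SOME p. ?P p)" by (rule someI[of ?P "(a, b)"]) (use assms in simp)
  then have d: "d \<noteq> 0" "a * d = c * b" using assms by (auto simp: s eq_fract)
  let ?f = "\<lambda>p. fps_to_fls (fps_of_poly p)"
  have "?f a * ?f d = ?f c * ?f b"
    using d(2) by (metis fls_times_fps_to_fls fps_of_poly_mult)
  with d(1) assms show ?thesis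
    unfolding fls_of_fract_def s by (simp add: field_simps fps_of_poly_eq_0_iff)
qed

lemma fls_of_fract_add: "fls_of_fract (p + q) = fls_of_fract p + fls_of_fract q"
  by (cases p; cases q)
    (simp add: fls_of_fract_Fract fps_of_poly_eq_0_iff fps_of_poly_add fps_of_poly_mult
      fls_times_fps_to_fls field_simps)

lemma fls_of_fract_mult: "fls_of_fract (p * q) = fls_of_fract p * fls_of_fract q"
  by (cases p; cases q)
    (simp add: fls_of_fract_Fract fps_of_poly_eq_0_iff fps_of_poly_mult
      fls_times_fps_to_fls field_simps)

lemma fls_of_fract_poly: "fls_of_fract (Fract p 1) = fps_to_fls (fps_of_poly p)"
  by (simp add: fls_of_fract_Fract)

lemma fls_of_fract_1: "fls_of_fract 1 = 1"
  using fls_of_fract_poly[of 1] by (simp add: One_fract_def)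

lemma countable_rat_poly: "countable (UNIV :: rat poly set)"
proof -
  have "(UNIV :: rat poly set) = range Poly"
    using Poly_coeffs by (metis surj_def)
  then show ?thesis by (metis countableI_type countable_image)
qed

lemma countable_range_fls_of_fract: "countable (range fls_of_fract)"
proof -
  have "q \<in> range (\<lambda>(a, b). Fract a b)" for q :: "rat poly fract"
    by (cases q) auto
  then have "range fls_of_fract \<subseteq> (\<lambda>(a, b). fls_of_fract (Fract a b)) ` (UNIV \<times> UNIV)"
    by (auto simp: image_iff) metis
  moreover have "countable ((UNIV :: rat poly set) \<times> (UNIV :: rat poly set))"
    using countable_rat_poly by (intro countable_SIGMA)
  ultimately show ?thesis by (meson countable_image countable_subset)
qed

text \<open>Q((t)) is a vector space over Q(t), in which the line through 1 is
  \<open>range fls_of_fract\<close>. So \<open>d\<close> and 1 are independent, and a Q(t)-linear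
  map may take any values on them.\<close>

lemma exists_linear_functional:
  assumes d: "d \<notin> range fls_of_fract"
  obtains f :: "rat fls \<Rightarrow> rat fls" where "\<And>x y. f (x + y) = f x + f y"
    "\<And>c x. f (fls_const c * x) = fls_const c * f x" "\<And>x. f (fls_X * x) = fls_X * f x"
    "f 1 = 0" "f d = 1"
proof -
  interpret K: vector_space "\<lambda>q x. fls_of_fract q * x"
    by unfold_locales (simp_all add: algebra_simps fls_of_fract_add fls_of_fract_mult fls_of_fract_1)
  interpret KK: vector_space_pair "\<lambda>q x. fls_of_fract q * x" "\<lambda>q x. fls_of_fract q * x" ..
  have "d \<notin> K.span {1}"
    using d by (auto simp: K.span_singleton)
  moreover have "\<not> K.dependent {1}"
    using K.dependent_single by simp
  ultimately have "\<not> K.dependent {d, 1}"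
    by (rule K.independent_insertI)
  then obtain f where f: "Vector_Spaces.linear (\<lambda>q x. fls_of_fract q * x) (\<lambda>q x. fls_of_fract q * x) f"
      "\<forall>x\<in>{d, 1}. f x = (if x = d then 1 else 0)"
    using KK.linear_independent_extend[of "{d, 1}" "\<lambda>x. if x = d then 1 else 0"] by blast
  interpret f: Vector_Spaces.linear "\<lambda>q x. fls_of_fract q * x" "\<lambda>q x. fls_of_fract q * x" f
    by (rule f(1))
  have poly: "f (fps_to_fls (fps_of_poly p) * x) = fps_to_fls (fps_of_poly p) * f x" for p x
    using f.scale[of "Fract p 1" x] by (simp add: fls_of_fract_poly)
  have "d \<noteq> 1" using d fls_of_fract_1 by (metis rangeI)
  show thesis
  proof
    show "f (fls_const c * x) = fls_const c * f x" for c x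
      using poly[of "[:c:]" x] by (simp add: fps_of_poly_const)
    show "f (fls_X * x) = fls_X * f x" for x
      using poly[of "[:0, 1:]" x] by simp
    show "f 1 = 0" "f d = 1" using f(2) \<open>d \<noteq> 1\<close> by auto
  qed (rule f.add)
qed


section \<open>Cocycles\<close>

text \<open>A 2-cocycle with trivial coefficients: an alternating bilinear form that, by the last
  condition, vanishes on the boundary of each wedge of \<open>a\<close>, \<open>b\<close> and
  \<open>c\<close>.\<close>

definition lie_cocycle :: "('a::lie_algebra \<Rightarrow> 'a \<Rightarrow> rat) \<Rightarrow> bool" where
  "lie_cocycle \<omega> \<longleftrightarrow>
    (\<forall>a b c. \<omega> (a + b) c = \<omega> a c + \<omega> b c) \<and> (\<forall>a b c. \<omega> a (b + c) = \<omega> a b + \<omega> a c) \<and>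
    (\<forall>r a b. \<omega> (r *\<^sub>Q a) b = r * \<omega> a b) \<and> (\<forall>r a b. \<omega> a (r *\<^sub>Q b) = r * \<omega> a b) \<and>
    (\<forall>a. \<omega> a a = 0) \<and>
    (\<forall>a b c. \<omega> (bracket a b) c - \<omega> (bracket a c) b + \<omega> (bracket b c) a = 0)"

lemma lie_cocycle_pullback:
  assumes "lie_hom h" "lie_cocycle \<omega>"
  shows "lie_cocycle (\<lambda>a b. \<omega> (h a) (h b))"
  using assms unfolding lie_cocycle_def lie_hom_def by (simp add: rat_linearD)

text \<open>Extension by 0 off length 2 yields a functional on all words, since
  \<open>exterior\<close> is the whole algebra and not a single degree.\<close>

fun eval_pair :: "('a \<Rightarrow> 'a \<Rightarrow> rat) \<Rightarrow> 'a list \<Rightarrow> rat" where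
  "eval_pair \<omega> [a, b] = \<omega> a b"
| "eval_pair \<omega> _ = 0"

lemma eval_pair_length: "length xs \<noteq> 2 \<Longrightarrow> eval_pair \<omega> xs = 0"
  by (cases "(\<omega>, xs)" rule: eval_pair.cases) auto

lemma ce_pairs_3:
  "ce_pairs (Suc (Suc (Suc 0))) = {(0, Suc 0), (0, Suc (Suc 0)), (Suc 0, Suc (Suc 0))}"
  by (auto simp: ce_pairs_def)

lemma lin_ext_word: "lin_ext f (word xs) = f xs"
  by (simp add: lin_ext_single scaleQ_one)

text \<open>The differential shortens words by one letter, so only length 3 can contribute; there
  the three pairs give the negative of the cocycle expression.\<close>

lemma lin_ext_ce_word:
  fixes \<omega> :: "'a::lie_algebra \<Rightarrow> 'a \<Rightarrow> rat"
  assumes "lie_cocycle \<omega>"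
  shows "lin_ext (eval_pair \<omega>) (ce_word xs) = 0"
proof -
  have eq: "lin_ext (eval_pair \<omega>) (ce_word xs) =
      (\<Sum>(i, j)\<in>ce_pairs (length xs).
        ce_sign (i, j) *\<^sub>Q eval_pair \<omega> (bracket (xs ! i) (xs ! j) # nths xs (- {i, j})))"
    by (simp add: ce_word_alt rat_linearD[OF linear_lin_ext] ce_summand_def lin_ext_word
        case_prod_unfold)
  show ?thesis
  proof (cases "length xs = 3")
    case True
    then obtain a b c where xs: "xs = [a, b, c]"
      by (auto simp: numeral_eq_Suc length_Suc_conv)
    have "\<omega> (bracket a b) c - \<omega> (bracket a c) b + \<omega> (bracket b c) a = 0"
      using assms by (simp add: lie_cocycle_def)
    moreover have "lin_ext (eval_pair \<omega>) (ce_word xs) =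
        - (\<omega> (bracket a b) c - \<omega> (bracket a c) b + \<omega> (bracket b c) a)"
      unfolding eq by (simp add: xs ce_pairs_3 ce_sign_def nths_Cons scaleQ_rat_def)
    ultimately show ?thesis by simp
  next
    case False
    have "length (nths xs (- {i, j})) \<noteq> 1" if "(i, j) \<in> ce_pairs (length xs)" for i j
    proof -
      have "{k. k < length xs \<and> k \<in> - {i, j}} = {..<length xs} - {i, j}" by auto
      moreover have "card ({..<length xs} - {i, j}) = length xs - 2"
        using that by (subst card_Diff_subset) (auto simp: ce_pairs_def)
      ultimately show ?thesis using that False by (auto simp: length_nths ce_pairs_def)
    qed
    then show ?thesis
      unfolding eq by (intro sum.neutral) (auto simp: eval_pair_length)
  qed
qed

text \<open>The words in a relator have equal length, so off length 2 all values are 0; at length 2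
  bilinearity and alternation apply.\<close>

lemma lin_ext_exterior_relators:
  fixes \<omega> :: "'a::lie_algebra \<Rightarrow> 'a \<Rightarrow> rat"
  assumes \<omega>: "lie_cocycle \<omega>" and r: "r \<in> rat_vector.span exterior_relators"
  shows "lin_ext (eval_pair \<omega>) r = 0"
  using r
proof (rule rat_vector.span_induct)
  show "rat_vector.subspace {r. lin_ext (eval_pair \<omega>) r = 0}"
    by (auto simp: rat_vector.subspace_def rat_linearD[OF linear_lin_ext])
  fix r :: "'a list \<Rightarrow>\<^sub>0 rat" assume "r \<in> exterior_relators"
  then consider (add) us x y vs where
        "r = word (us @ (x + y) # vs) - word (us @ x # vs) - word (us @ y # vs)"
      | (scale) us c x vs where "r = word (us @ (c *\<^sub>Q x) # vs) - c *\<^sub>Q word (us @ x # vs)"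
      | (self) us x vs where "r = word (us @ x # x # vs)"
    unfolding exterior_relators_def by blast
  then show "lin_ext (eval_pair \<omega>) r = 0"
  proof cases
    case add
    show ?thesis
    proof (cases "length (us @ x # vs) = 2")
      case True
      then consider v where "us = []" "vs = [v]" | u where "us = [u]" "vs = []"
        by (cases us) (auto simp: length_Suc_conv numeral_eq_Suc)
      then show ?thesis
        using \<omega> by cases (simp_all add: add rat_linearD[OF linear_lin_ext] lin_ext_word lie_cocycle_def)
    qed (simp add: add rat_linearD[OF linear_lin_ext] lin_ext_word eval_pair_length)
  next
    case scale
    show ?thesis
    proof (cases "length (us @ x # vs) = 2")
      case True
      then consider v where "us = []" "vs = [v]" | u where "us = [u]" "vs = []"
        by (cases us) (auto simp: length_Suc_conv numeral_eq_Suc)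
      then show ?thesis
        using \<omega> by cases (simp_all add: scale rat_linearD[OF linear_lin_ext] lin_ext_word
            lie_cocycle_def scaleQ_rat_def)
    qed (simp add: scale rat_linearD[OF linear_lin_ext] lin_ext_word eval_pair_length)
  next
    case self
    show ?thesis
    proof (cases "us = [] \<and> vs = []")
      case True
      then show ?thesis using \<omega> by (simp add: self lin_ext_word lie_cocycle_def)
    qed (auto simp: self lin_ext_word eval_pair_length)
  qed
qed

text \<open>Such a \<open>W\<close> takes equal values on homologous cycles. It is evaluated on a
  representative, and \<open>lin_ext_exterior_relators\<close> makes the choice harmless.\<close>

lemma lie_cocycle_functional:
  fixes \<omega> :: "'a::lie_algebra \<Rightarrow> 'a \<Rightarrow> rat"
  assumes \<omega>: "lie_cocycle \<omega>"
  obtains W :: "'a exterior \<Rightarrow> rat" where "\<And>x y. W (x - y) = W x - W y"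
    "\<And>a b. W (wedge [a, b]) = \<omega> a b" "\<And>z. W (ce_diff z) = 0"
proof
  let ?l = "lin_ext (eval_pair \<omega>)"
  let ?W = "\<lambda>z. ?l (rep_exterior z)"
  have abs: "?W (abs_exterior p) = ?l p" for p
  proof -
    have "exterior_rel (rep_exterior (abs_exterior p)) p"
      by (rule Quotient_rep_abs[OF Quotient_exterior])
        (simp add: exterior_rel_def rat_vector.span_zero)
    then have "?l (rep_exterior (abs_exterior p) - p) = 0"
      using lin_ext_exterior_relators[OF \<omega>] by (simp add: exterior_rel_def)
    then show ?thesis by (simp add: rat_linearD[OF linear_lin_ext])
  qed
  have ex: "\<exists>p. z = abs_exterior p" for z :: "'a exterior"
    by (metis Quotient_abs_rep[OF Quotient_exterior])
  show "?W (x - y) = ?W x - ?W y" for x y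
  proof -
    obtain p q where "x = abs_exterior p" "y = abs_exterior q" using ex by metis
    then show ?thesis by (simp add: minus_exterior.abs_eq abs rat_linearD[OF linear_lin_ext])
  qed
  show "?W (wedge [a, b]) = \<omega> a b" for a b
    by (simp add: wedge.abs_eq abs lin_ext_word)
  show "?W (ce_diff z) = 0" for z
  proof -
    obtain p where "z = abs_exterior p" using ex by metis
    then have "?W (ce_diff z) = ?l (lin_ext ce_word p)" by (simp add: ce_diff.abs_eq abs)
    also have "\<dots> = 0"
      by (subst (2) lin_ext_def)
        (simp add: rat_linearD[OF linear_lin_ext] lin_ext_ce_word[OF \<omega>])
    finally show ?thesis .
  qed
qed


section \<open>The Lie algebra \<open>\<rat>[[t]] \<rtimes> \<rat>\<close>\<close>

text \<open>\<open>Semidirect m r\<close> stands for \<open>m + r x\<close>, where \<open>x\<close> acts on the abelian ideal \<open>\<rat>[[t]]\<close>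
  as multiplication by \<open>t\<close>.\<close>

datatype semidirect = Semidirect (series: "rat fps") (shift: rat)

instantiation semidirect :: lie_algebra
begin

definition "0 = Semidirect 0 0"
definition "a + b = Semidirect (series a + series b) (shift a + shift b)"
definition "- a = Semidirect (- series a) (- shift a)"
definition "a - b = Semidirect (series a - series b) (shift a - shift b)"
definition "c *\<^sub>Q a = Semidirect (fps_const c * series a) (c * shift a)"
definition "bracket a b =
  Semidirect (fps_X * (fps_const (shift a) * series b - fps_const (shift b) * series a)) 0"

instance
  by standard
    (simp_all add: zero_semidirect_def plus_semidirect_def uminus_semidirect_def
      minus_semidirect_def scaleQ_semidirect_def bracket_semidirect_def algebra_simps
      flip: fps_const_add fps_const_mult)

end

lemmas semidirect_defs = zero_semidirect_def plus_semidirect_def uminus_semidirect_def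
  minus_semidirect_def scaleQ_semidirect_def bracket_semidirect_def

lemma semidirect_sel [simp]:
  "series 0 = 0" "shift 0 = 0"
  "series (a + b) = series a + series b" "shift (a + b) = shift a + shift b"
  "series (- a) = - series a" "shift (- a) = - shift a"
  "series (a - b) = series a - series b" "shift (a - b) = shift a - shift b"
  "series (c *\<^sub>Q a) = fps_const c * series a" "shift (c *\<^sub>Q a) = c * shift a"
  "series (bracket a b) =
     fps_X * (fps_const (shift a) * series b - fps_const (shift b) * series a)"
  "shift (bracket a b) = 0"
  by (simp_all add: semidirect_defs)

section \<open>Lower central series and homomorphisms\<close>

text \<open>Each bracket has shift 0 and carries a factor t, so for n >= 2 the n-th term lies in
  t^(n-1) Q[[t]].\<close>

lemma lower_central_semidirect:
  assumes "a \<in> lower_central n"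
  shows "(2 \<le> n \<longrightarrow> shift a = 0) \<and> (\<forall>k. k + 1 < n \<longrightarrow> fps_nth (series a) k = 0)"
  using assms
proof (induction n arbitrary: a rule: induct_nat_012)
  case (ge2 n)
  let ?V = "{a. shift a = 0 \<and> (\<forall>k. k < Suc n \<longrightarrow> fps_nth (series a) k = 0)}"
  have "rat_vector.subspace ?V"
    by (auto simp: rat_vector.subspace_def)
  moreover have "{bracket x y |x y. y \<in> lower_central (Suc n)} \<subseteq> ?V"
  proof safe
    fix x y :: semidirect and k
    assume "y \<in> lower_central (Suc n)" "k < Suc n"
    with ge2.IH(2)[OF this(1)] show "fps_nth (series (bracket x y)) k = 0"
      by (cases k) auto
  qed simp
  ultimately have "lower_central (Suc (Suc n)) \<subseteq> ?V"
    unfolding lower_central.simps by (intro rat_vector.span_minimal)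
  with ge2.prems show ?case by auto
qed auto

lemma lie_hom_lower_central:
  assumes h: "lie_hom h" and "a \<in> lower_central n"
  shows "h a \<in> lower_central n"
  using assms(2)
proof (induction n arbitrary: a rule: induct_nat_012)
  case (ge2 n)
  have lin: "rat_linear h" using h by (simp add: lie_hom_def)
  have "h b \<in> lower_central (Suc (Suc n))"
    if "b \<in> rat_vector.span {bracket x y |x y. y \<in> lower_central (Suc n)}" for b
    using that
  proof (rule rat_vector.span_induct)
    show "rat_vector.subspace {b. h b \<in> lower_central (Suc (Suc n))}"
      by (auto simp: rat_vector.subspace_def rat_linearD[OF lin] simp del: lower_central.simps
          intro: lower_central_add lower_central_scale lower_central_zero)
    show "h b \<in> lower_central (Suc (Suc n))"
      if b: "b \<in> {bracket x y |x y. y \<in> lower_central (Suc n)}" for b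
    proof -
      obtain x y where "b = bracket x y" "y \<in> lower_central (Suc n)"
        using b by blast
      with ge2.IH(2)[of y] h have "h b = bracket (h x) (h y)" "h y \<in> lower_central (Suc n)"
        by (simp_all add: lie_hom_def)
      then show ?thesis unfolding lower_central.simps by (blast intro: rat_vector.span_base)
    qed
  qed
  with ge2.prems show ?case by simp
qed auto

section \<open>Extension of homomorphisms to the completion\<close>

text \<open>For a homomorphism \<open>p\<close>, \<open>lower_central_semidirect\<close> makes
  coefficient \<open>n\<close> well defined modulo \<open>lower_central (n + 2)\<close> and the
  shift modulo \<open>lower_central 2\<close>; hence the indices \<open>n + 2\<close> and 2.\<close>

definition completion_ext :: "('a::lie_algebra \<Rightarrow> semidirect) \<Rightarrow> 'a completion \<Rightarrow> semidirect" where
  "completion_ext p \<xi> = Semidirect (Abs_fps (\<lambda>n. fps_nth (series (p (rep_completion \<xi> (n + 2)))) n))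
    (shift (p (rep_completion \<xi> 2)))"

lemma coherent_completion_rel: "coherent f \<longleftrightarrow> completion_rel f f"
  by (simp add: completion_rel_def lower_central_zero)

lemma obtain_coherent:
  obtains f where "\<xi> = abs_completion f" "coherent f"
  by (metis Quotient_abs_rep[OF Quotient_completion] Quotient_rep_reflp[OF Quotient_completion]
      coherent_completion_rel)

text \<open>Successive components beyond \<open>n + 2\<close> differ by elements of
  \<open>lower_central j\<close> with \<open>j\<close> at least \<open>n + 2\<close>, which have
  coefficient 0 at \<open>n\<close> and shift 0.\<close>

lemma coherent_stable:
  assumes p: "lie_hom p" and f: "coherent f" and "n + 2 \<le> k"
  shows "fps_nth (series (p (f k))) n = fps_nth (series (p (f (n + 2)))) n"
    and "shift (p (f k)) = shift (p (f 2))"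
proof -
  have lin: "rat_linear p" using p by (simp add: lie_hom_def)
  have step: "p (f (Suc j)) - p (f j) \<in> lower_central j" for j
    using f lie_hom_lower_central[OF p] by (simp add: coherent_def flip: rat_linearD[OF lin])
  show "fps_nth (series (p (f k))) n = fps_nth (series (p (f (n + 2)))) n"
    using assms(3)
  proof (induction k rule: dec_induct)
    case (step j)
    then show ?case using lower_central_semidirect[OF \<open>p (f (Suc j)) - p (f j) \<in> lower_central j\<close>] by auto
  qed simp
  have "2 \<le> k" using assms(3) by simp
  then show "shift (p (f k)) = shift (p (f 2))"
  proof (induction k rule: dec_induct)
    case (step j)
    then show ?case using lower_central_semidirect[OF \<open>p (f (Suc j)) - p (f j) \<in> lower_central j\<close>] by auto
  qed simp
qed

lemma completion_ext_abs:
  assumes p: "lie_hom p" and f: "coherent f"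
  shows "completion_ext p (abs_completion f) =
    Semidirect (Abs_fps (\<lambda>n. fps_nth (series (p (f (n + 2)))) n)) (shift (p (f 2)))"
proof -
  let ?g = "rep_completion (abs_completion f)"
  have lin: "rat_linear p" using p by (simp add: lie_hom_def)
  have "completion_rel ?g f"
    using Quotient_rep_abs[OF Quotient_completion] f by (simp add: coherent_completion_rel)
  then have "p (?g n) - p (f n) \<in> lower_central n" for n
    using lie_hom_lower_central[OF p] by (simp add: completion_rel_def flip: rat_linearD[OF lin])
  note * = lower_central_semidirect[OF this]
  have "fps_nth (series (p (?g (n + 2)))) n = fps_nth (series (p (f (n + 2)))) n" for n
    using *[of "n + 2"] by auto
  moreover have "shift (p (?g 2)) = shift (p (f 2))"
    using *[of 2] by auto
  ultimately show ?thesis by (simp add: completion_ext_def)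
qed

lemma coherent_bracket:
  assumes "coherent f" "coherent g"
  shows "coherent (\<lambda>n. bracket (f n) (g n))"
  using assms bracket_completion.rsp by (auto simp: coherent_completion_rel rel_fun_def)

lemma coherent_add:
  assumes "coherent f" "coherent g"
  shows "coherent (\<lambda>n. f n + g n)"
  using assms plus_completion.rsp by (auto simp: coherent_completion_rel rel_fun_def)

lemma coherent_scale:
  assumes "coherent f"
  shows "coherent (\<lambda>n. c *\<^sub>Q f n)"
  using assms scaleQ_completion.rsp by (auto simp: coherent_completion_rel rel_fun_def)

lemma lie_hom_completion_ext:
  fixes p :: "'a::lie_algebra \<Rightarrow> semidirect"
  assumes p: "lie_hom p"
  shows "lie_hom (completion_ext p)"
proof -
  have lin: "rat_linear p" using p by (simp add: lie_hom_def)
  note ext = completion_ext_abs[OF p]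
  have "completion_ext p (\<xi> + \<eta>) = completion_ext p \<xi> + completion_ext p \<eta>" for \<xi> \<eta>
  proof -
    obtain f g where "\<xi> = abs_completion f" "coherent f" "\<eta> = abs_completion g" "coherent g"
      by (metis obtain_coherent)
    moreover from this have "\<xi> + \<eta> = abs_completion (\<lambda>n. f n + g n)"
      using plus_completion.abs_eq by (simp add: coherent_completion_rel)
    ultimately show ?thesis
      by (simp add: ext coherent_add rat_linearD[OF lin] plus_semidirect_def fps_eq_iff)
  qed
  moreover have "completion_ext p (c *\<^sub>Q \<xi>) = c *\<^sub>Q completion_ext p \<xi>" for c \<xi>
  proof -
    obtain f where "\<xi> = abs_completion f" "coherent f"
      by (metis obtain_coherent)
    moreover from this have "c *\<^sub>Q \<xi> = abs_completion (\<lambda>n. c *\<^sub>Q f n)"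
      using scaleQ_completion.abs_eq by (simp add: coherent_completion_rel)
    ultimately show ?thesis
      by (simp add: ext coherent_scale rat_linearD[OF lin] scaleQ_semidirect_def fps_eq_iff)
  qed
  moreover have "completion_ext p (bracket \<xi> \<eta>) = bracket (completion_ext p \<xi>) (completion_ext p \<eta>)"
    for \<xi> \<eta>
  proof -
    obtain f g where fg: "\<xi> = abs_completion f" "coherent f" "\<eta> = abs_completion g" "coherent g"
      by (metis obtain_coherent)
    then have eq: "bracket \<xi> \<eta> = abs_completion (\<lambda>n. bracket (f n) (g n))"
      using bracket_completion.abs_eq by (simp add: coherent_completion_rel)
    have brk: "p (bracket a b) = bracket (p a) (p b)" for a b
      using p by (simp add: lie_hom_def)
    have "fps_nth (series (p (bracket (f (n + 2)) (g (n + 2))))) n =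
      fps_nth (series (bracket (completion_ext p \<xi>) (completion_ext p \<eta>))) n" for n
    proof (cases n)
      case (Suc m)
      \<comment> \<open>The factor t in the bracket turns coefficient \<open>n\<close> into
        coefficient \<open>m\<close> of the entries, still read at index \<open>n + 2\<close>;
        stability moves it to \<open>m + 2\<close>.\<close>
      then have "m + 2 \<le> n + 2" by simp
      from coherent_stable[OF p fg(2) this] coherent_stable[OF p fg(4) this] Suc
      show ?thesis by (simp add: brk fg ext)
    qed (simp add: brk)
    then show ?thesis
      unfolding eq ext[OF coherent_bracket[OF fg(2,4)]]
      by (intro semidirect.expand) (simp add: fps_eq_iff brk)
  qed
  ultimately show ?thesis by (simp add: lie_hom_def rat_linearI)
qed

section \<open>The twisted form on Q[[t]]\<close>

text \<open>The substitution of -t for t.\<close>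

definition twist :: "rat fps \<Rightarrow> rat fps" where
  "twist m = Abs_fps (\<lambda>n. (-1) ^ n * fps_nth m n)"

lemma twist_simps:
  "twist (m + n) = twist m + twist n" "twist (m - n) = twist m - twist n"
  "twist (fps_const c * m) = fps_const c * twist m"
  "twist (fps_X * m) = - (fps_X * twist m)"
  "twist 1 = 1"
proof -
  show "twist (fps_X * m) = - (fps_X * twist m)"
  proof (rule fps_ext)
    show "fps_nth (twist (fps_X * m)) n = fps_nth (- (fps_X * twist m)) n" for n
      by (cases n) (simp_all add: twist_def)
  qed
qed (simp_all add: twist_def fps_eq_iff algebra_simps)

text \<open>The form is skew for multiplication by \<open>t\<close>, that is \<open>B(tm, n) + B(m, tn) = 0\<close>,
  because \<open>f\<close> commutes with \<open>t\<close> while the twist \<open>t \<mapsto> -t\<close> anticommutes with it.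
  This is the closedness of \<open>B\<close> as a cocycle.\<close>

lemma lie_cocycle_twist:
  fixes f :: "rat fls \<Rightarrow> rat fls"
  assumes add: "\<And>x y. f (x + y) = f x + f y"
    and const: "\<And>c x. f (fls_const c * x) = fls_const c * f x"
    and X: "\<And>x. f (fls_X * x) = fls_X * f x"
  shows "lie_cocycle (\<lambda>a b. fls_nth (fps_to_fls (twist (series a)) * f (fps_to_fls (series b)) -
    fps_to_fls (twist (series b)) * f (fps_to_fls (series a))) 0)"
proof -
  have diff: "f (x - y) = f x - f y" for x y
    using add[of "x - y" y] by simp
  note simps = twist_simps fls_times_fps_to_fls add diff const X
  show ?thesis
    unfolding lie_cocycle_def
    by (intro conjI allI; simp add: simps right_diff_distrib left_diff_distrib; simp add: algebra_simps)
qed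


section \<open>The cycles\<close>

lemma rat_linear_bracket: "rat_linear (bracket (x :: 'a::lie_algebra))"
  by (rule rat_linearI) (simp_all add: bracket_add_right bracket_scale_right)

lemma bracket_derivation:
  "bracket x (bracket a b) = bracket (bracket x a) b + bracket a (bracket x (b :: 'a::lie_algebra))"
proof -
  have 1: "bracket a (bracket b x) = - bracket a (bracket x b)"
    by (simp add: bracket_antisym[of b x] bracket_minus_right)
  have 2: "bracket b (bracket x a) = - bracket (bracket x a) b"
    by (rule bracket_antisym)
  show ?thesis
    using jacobi[of x a b] unfolding 1 2 by (simp add: algebra_simps)
qed

abbreviation ad_pow :: "'a::lie_algebra \<Rightarrow> nat \<Rightarrow> 'a \<Rightarrow> 'a" where
  "ad_pow x n \<equiv> bracket x ^^ n"

definition alt_brackets :: "'a::lie_algebra \<Rightarrow> 'a \<Rightarrow> nat \<Rightarrow> 'a" where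
  "alt_brackets x y k =
    (\<Sum>i<k. (-1) ^ i *\<^sub>Q bracket (ad_pow x i y) (ad_pow x (2 * k - Suc i) y))"

text \<open>The expansion telescopes, and its last term is the bracket of \<open>ad_pow x k y\<close> with itself.\<close>

lemma bracket_alt_brackets:
  "bracket x (alt_brackets x y k) = bracket y (ad_pow x (2 * k) y)"
proof -
  define T where "T i = (-1) ^ i *\<^sub>Q bracket (ad_pow x i y) (ad_pow x (2 * k - i) y)" for i
  have "bracket x ((-1) ^ i *\<^sub>Q bracket (ad_pow x i y) (ad_pow x (2 * k - Suc i) y)) =
      T i - T (Suc i)" if "i < k" for i
  proof -
    have "2 * k - i = Suc (2 * k - Suc i)" using that by simp
    then have "ad_pow x (2 * k - i) y = bracket x (ad_pow x (2 * k - Suc i) y)" by simp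
    then show ?thesis
      by (simp add: T_def bracket_scale_right bracket_derivation[of x "ad_pow x i y"]
          scaleQ_add_right)
  qed
  then have "bracket x (alt_brackets x y k) = (\<Sum>i<k. T i - T (Suc i))"
    by (simp add: alt_brackets_def rat_linearD(6)[OF rat_linear_bracket])
  also have "\<dots> = T 0 - T k" by (rule sum_lessThan_telescope')
  also have "T k = 0" by (simp add: T_def bracket_self flip: mult_2)
  finally show ?thesis by (simp add: T_def scaleQ_one)
qed

lemma lower_central_antimono:
  assumes "m \<le> n"
  shows "lower_central n \<subseteq> (lower_central m :: 'a::lie_algebra set)"
  using lift_Suc_antimono_le[of lower_central, OF lower_central_Suc_subset assms] .

lemma ad_pow_lower_central: "ad_pow x n y \<in> lower_central n"
proof -
  have "ad_pow x n y \<in> lower_central (Suc n)"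
    by (induction n) (auto intro: rat_vector.span_base)
  then show ?thesis using lower_central_Suc_subset by blast
qed

text \<open>Needed for the series of these elements to converge: \<open>i < k\<close> forces the
  second exponent to be at least \<open>k\<close>.\<close>

lemma alt_brackets_lower_central: "alt_brackets x y k \<in> lower_central k"
  unfolding alt_brackets_def
proof (intro rat_vector.subspace_sum[OF subspace_lower_central] lower_central_scale
    lower_central_bracket_right)
  fix i assume "i \<in> {..<k}"
  then have "k \<le> 2 * k - Suc i" by simp
  then show "ad_pow x (2 * k - Suc i) y \<in> lower_central k"
    using lower_central_antimono ad_pow_lower_central by blast
qed

section \<open>Infinite sums in the completion\<close>

text \<open>An infinite sum, for \<open>z k\<close> in \<open>lower_central k\<close>: modulo
  \<open>lower_central n\<close> only the terms below \<open>n\<close> survive.\<close>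

definition completion_series :: "(nat \<Rightarrow> rat) \<Rightarrow> (nat \<Rightarrow> 'a::lie_algebra) \<Rightarrow> 'a completion" where
  "completion_series c z = abs_completion (\<lambda>n. \<Sum>k<n. c k *\<^sub>Q z k)"

definition completion_const :: "'a::lie_algebra \<Rightarrow> 'a completion" where
  "completion_const a = abs_completion (\<lambda>_. a)"

lemma coherent_const: "coherent (\<lambda>_. a)"
  by (simp add: coherent_def lower_central_zero)

lemma coherent_series:
  assumes "\<And>k. z k \<in> lower_central k"
  shows "coherent (\<lambda>n. \<Sum>k<n. c k *\<^sub>Q z k)"
  using assms by (simp add: coherent_def lower_central_scale)

lemma bracket_completion_const_series:
  assumes "\<And>k. z k \<in> lower_central k"
  shows "bracket (completion_const a) (completion_series c z) =
    completion_series c (\<lambda>k. bracket a (z k))"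
  using bracket_completion.abs_eq[of "\<lambda>_. a" "\<lambda>n. \<Sum>k<n. c k *\<^sub>Q z k"]
    coherent_const[of a] coherent_series[OF assms, of c]
  by (simp add: completion_const_def completion_series_def coherent_completion_rel
      rat_linearD[OF rat_linear_bracket])

text \<open>Only even exponents occur, because the telescoping in
  \<open>bracket_alt_brackets\<close> has to end in the bracket of \<open>ad_pow x k y\<close> with
  itself.\<close>

definition completion_cycle :: "'a::lie_algebra \<Rightarrow> 'a \<Rightarrow> (nat \<Rightarrow> rat) \<Rightarrow> 'a completion exterior" where
  "completion_cycle x y c =
    wedge [completion_const y, completion_series c (\<lambda>k. ad_pow x (2 * k) y)] -
    wedge [completion_const x, completion_series c (alt_brackets x y)]"

lemma ad_pow_double_lower_central: "ad_pow x (2 * k) y \<in> lower_central k"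
  using ad_pow_lower_central[of "2 * k" x y] lower_central_antimono[of k "2 * k"] by auto

lemma ce_diff_wedge_pair: "ce_diff (wedge [a, b]) = - wedge [bracket a b]"
proof -
  have "{(i, j). i < j \<and> j < length [a, b]} = {(0, 1)}" by auto
  then show ?thesis
    unfolding ce_diff_wedge by (simp add: nths_Cons scaleQ_one rat_vector.scale_minus_left)
qed

text \<open>Applied termwise, \<open>bracket_alt_brackets\<close> gives both wedges the same
  boundary.\<close>

lemma ce_diff_completion_cycle: "ce_diff (completion_cycle x y c) = 0"
  by (simp add: completion_cycle_def ce_diff_simps ce_diff_wedge_pair
      bracket_completion_const_series ad_pow_double_lower_central alt_brackets_lower_central
      bracket_alt_brackets)

lemma completion_cycle_exterior_power: "completion_cycle x y c \<in> exterior_power 2"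
  unfolding completion_cycle_def exterior_power_def
  by (intro rat_vector.span_diff rat_vector.span_base) (auto intro!: exI)

section \<open>Images of the cycles in the semidirect product\<close>

definition even_series :: "(nat \<Rightarrow> rat) \<Rightarrow> rat fps" where
  "even_series c = Abs_fps (\<lambda>n. if even n then c (n div 2) else 0)"

lemma twist_even_series: "twist (even_series c) = even_series c"
  by (simp add: twist_def even_series_def fps_eq_iff)

lemma even_series_eq_iff: "even_series c = even_series c' \<longleftrightarrow> c = c'"
proof
  assume "even_series c = even_series c'"
  then have "fps_nth (even_series c) (2 * n) = fps_nth (even_series c') (2 * n)" for n by simp
  then show "c = c'" by (simp add: even_series_def fun_eq_iff)
qed simp

lemma semidirect_sum:
  "series (\<Sum>a\<in>A. g a) = (\<Sum>a\<in>A. series (g a))" "shift (\<Sum>a\<in>A. g a) = (\<Sum>a\<in>A. shift (g a))"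
  by (induction A rule: infinite_finite_induct) simp_all

context
  fixes p :: "'a::lie_algebra \<Rightarrow> semidirect" and x y :: 'a
  assumes p: "lie_hom p" and px: "p x = Semidirect 0 1" and py: "p y = Semidirect 1 0"
begin

lemma p_linear: "rat_linear p" and p_bracket: "p (bracket a b) = bracket (p a) (p b)"
  using p by (simp_all add: lie_hom_def)

lemma p_ad_pow: "p (ad_pow x i y) = Semidirect (fps_X ^ i) 0"
  by (induction i) (simp_all add: py px p_bracket bracket_semidirect_def)

text \<open>Both entries of each bracket land in the abelian ideal Q[[t]].\<close>

lemma p_alt_brackets: "p (alt_brackets x y k) = 0"
  by (simp add: alt_brackets_def rat_linearD[OF p_linear] p_bracket p_ad_pow
      bracket_semidirect_def flip: zero_semidirect_def)

lemma completion_ext_const: "completion_ext p (completion_const a) = p a"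
  by (rule semidirect.expand)
    (simp add: completion_const_def completion_ext_abs[OF p coherent_const] fps_eq_iff)

lemma completion_ext_ad_pow_series:
  "completion_ext p (completion_series c (\<lambda>k. ad_pow x (2 * k) y)) = Semidirect (even_series c) 0"
proof -
  \<comment> \<open>Only \<open>k = n div 2\<close> can match, and it is in range once
    \<open>n < N\<close>; coefficient \<open>n\<close> is read at \<open>N = n + 2\<close>.\<close>
  have *: "(\<Sum>k<N. c k * (if n = 2 * k then 1 else 0)) = fps_nth (even_series c) n"
    if "n < N" for n N
  proof -
    have "(\<Sum>k<N. c k * (if n = 2 * k then 1 else 0)) =
        (\<Sum>k<N. if k = n div 2 then (if even n then c k else 0) else 0)"
      by (rule sum.cong) auto
    moreover have "n div 2 < N" using that by simp
    ultimately show ?thesis by (simp add: even_series_def)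
  qed
  show ?thesis
    unfolding completion_series_def
    by (simp add: completion_ext_abs[OF p coherent_series] ad_pow_double_lower_central
        rat_linearD[OF p_linear] p_ad_pow semidirect_sum fps_sum_nth fps_eq_iff * del: sum.lessThan_Suc)
qed

lemma completion_ext_alt_brackets_series:
  "completion_ext p (completion_series c (alt_brackets x y)) = 0"
  unfolding completion_series_def
  by (rule semidirect.expand)
    (simp add: completion_ext_abs[OF p coherent_series] alt_brackets_lower_central
      rat_linearD[OF p_linear] p_alt_brackets fps_eq_iff)

text \<open>Otherwise a Q(t)-linear \<open>f\<close> with value 0 at 1 and 1 at the difference gives
  a cocycle whose functional takes values differing by 1 on the two cycles.\<close>

lemma homologous_cycles_imp_rational:
  assumes "ce_homologous (completion_cycle x y c) (completion_cycle x y c')"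
  shows "fps_to_fls (even_series c - even_series c') \<in> range fls_of_fract"
proof (rule ccontr)
  assume "fps_to_fls (even_series c - even_series c') \<notin> range fls_of_fract"
  then obtain f :: "rat fls \<Rightarrow> rat fls" where add: "\<And>x y. f (x + y) = f x + f y"
    and const: "\<And>c x. f (fls_const c * x) = fls_const c * f x"
    and X: "\<And>x. f (fls_X * x) = fls_X * f x"
    and f: "f 1 = 0" "f (fps_to_fls (even_series c - even_series c')) = 1"
    using exists_linear_functional by blast
  let ?h = "completion_ext p"
  obtain W :: "'a completion exterior \<Rightarrow> rat" where W: "\<And>x y. W (x - y) = W x - W y"
    "\<And>a b. W (wedge [a, b]) =
      fls_nth (fps_to_fls (twist (series (?h a))) * f (fps_to_fls (series (?h b))) -
        fps_to_fls (twist (series (?h b))) * f (fps_to_fls (series (?h a)))) 0"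
    "\<And>z. W (ce_diff z) = 0"
    using lie_cocycle_functional[OF
        lie_cocycle_pullback[OF lie_hom_completion_ext[OF p] lie_cocycle_twist[OF add const X]]]
    by blast
  have f0: "f 0 = 0" using const[of 0] by simp
  have twist0: "twist 0 = 0" by (simp add: twist_def fps_eq_iff)
  \<comment> \<open>The first wedge maps to 1 wedge g, and \<open>f 1 = 0\<close> leaves only the
    constant term of f(g). The wedge with \<open>x\<close> contributes 0, as both its entries have
    series 0.\<close>
  have W_cycle: "W (completion_cycle x y e) = fls_nth (f (fps_to_fls (even_series e))) 0" for e
    by (simp add: completion_cycle_def W completion_ext_const px py twist0 twist_simps(5) f0 f
        completion_ext_ad_pow_series completion_ext_alt_brackets_series twist_even_series)
  obtain z where "completion_cycle x y c - completion_cycle x y c' = ce_diff z"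
    using assms by (auto simp: ce_homologous_def)
  then have "W (completion_cycle x y c) = W (completion_cycle x y c')"
    by (metis W(1,3) eq_iff_diff_eq_0)
  moreover have "f (fps_to_fls (even_series c)) = f (fps_to_fls (even_series c')) + 1"
    using add[of "fps_to_fls (even_series c - even_series c')" "fps_to_fls (even_series c')"] f
    by (simp add: add.commute)
  ultimately show False by (simp add: W_cycle)
qed

text \<open>Uncountably many sequences index the cycles, and each class is hit only countably often:
  within a fibre the even series differ from a fixed one by elements of Q(t).\<close>

lemma uncountable_ce_homology_degree_2:
  "uncountable (ce_homology_degree 2 :: 'a completion ce_homology set)"
proof
  assume *: "countable (ce_homology_degree 2 :: 'a completion ce_homology set)"
  let ?cl = "\<lambda>c. abs_ce_homology (completion_cycle x y c)"
  \<comment> \<open>\<open>ce_homologous\<close> is a partial equivalence, so equality of classes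
    yields a homology only between cycles.\<close>
  have cycle: "ce_homologous (completion_cycle x y c) (completion_cycle x y c)" for c
    by (simp add: ce_homologous_def ce_diff_completion_cycle ce_boundary_zero)
  have "range ?cl \<subseteq> ce_homology_degree 2"
    by (auto simp: ce_homology_degree_def ce_diff_completion_cycle completion_cycle_exterior_power)
  with * have "countable (range ?cl)" by (rule countable_subset[rotated])
  moreover have "countable {c. ?cl c = ?cl c'}" for c'
  proof (rule countable_image_inj_on)
    have "(\<lambda>c. fps_to_fls (even_series c - even_series c')) ` {c. ?cl c = ?cl c'}
        \<subseteq> range fls_of_fract"
    proof (rule image_subsetI, rule homologous_cycles_imp_rational)
      show "ce_homologous (completion_cycle x y c) (completion_cycle x y c')"
        if "c \<in> {c. ?cl c = ?cl c'}" for c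
        using that cycle Quotient_rel[OF Quotient_ce_homology] by blast
    qed
    then show "countable ((\<lambda>c. fps_to_fls (even_series c - even_series c')) ` {c. ?cl c = ?cl c'})"
      using countable_range_fls_of_fract by (rule countable_subset)
    show "inj_on (\<lambda>c. fps_to_fls (even_series c - even_series c')) {c. ?cl c = ?cl c'}"
      by (auto simp: inj_on_def even_series_eq_iff simp del: fps_to_fls_minus)
  qed
  ultimately have "countable (\<Union>v\<in>range ?cl. {c. ?cl c = v})"
    by (intro countable_UN) auto
  moreover have "(\<Union>v\<in>range ?cl. {c. ?cl c = v}) = UNIV" by auto
  ultimately show False using uncountable_rat_sequences by simp
qed

end

lemma subspace_ce_homology_degree: "rat_vector.subspace (ce_homology_degree n)"
proof -
  let ?Z = "{z \<in> exterior_power n. ce_diff z = 0} :: 'a exterior set"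
  have rel: "ce_homologous z z" if "z \<in> ?Z" for z
    using that by (simp add: ce_homologous_def ce_boundary_zero)
  have Z: "rat_vector.subspace ?Z"
    unfolding exterior_power_def
    by (auto simp: rat_vector.subspace_def ce_diff_simps rat_vector.span_zero rat_vector.span_add
        rat_vector.span_scale)
  show ?thesis
    unfolding ce_homology_degree_def rat_vector.subspace_def
  proof (intro conjI ballI allI)
    show "0 \<in> abs_ce_homology ` ?Z"
      using rat_vector.subspace_0[OF Z] unfolding zero_ce_homology_def by blast
    fix a assume "a \<in> abs_ce_homology ` ?Z"
    then obtain z where z: "a = abs_ce_homology z" "z \<in> ?Z" by blast
    show "c *\<^sub>Q a \<in> abs_ce_homology ` ?Z" for c
      using z scaleQ_ce_homology.abs_eq[OF rel[OF z(2)]] rat_vector.subspace_scale[OF Z z(2)] by auto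
    fix b assume "b \<in> abs_ce_homology ` ?Z"
    then obtain w where w: "b = abs_ce_homology w" "w \<in> ?Z" by blast
    show "a + b \<in> abs_ce_homology ` ?Z"
      using z w plus_ce_homology.abs_eq[OF rel[OF z(2)] rel[OF w(2)]]
        rat_vector.subspace_add[OF Z z(2) w(2)] by auto
  qed
qed


section \<open>Two generators\<close>

lemma lie_hom_inv:
  assumes "lie_iso \<phi>"
  shows "lie_hom (inv \<phi>)"
proof -
  have \<phi>: "lie_hom \<phi>" "bij \<phi>" using assms by (simp_all add: lie_iso_def)
  then have lin: "rat_linear \<phi>" by (simp add: lie_hom_def)
  have inv: "inv \<phi> (\<phi> a) = a" "\<phi> (inv \<phi> b) = b" for a b
    using \<phi>(2) by (simp_all add: bij_is_inj bij_is_surj surj_f_inv_f)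
  have "inv \<phi> (a + b) = inv \<phi> a + inv \<phi> b" "inv \<phi> (c *\<^sub>Q a) = c *\<^sub>Q inv \<phi> a"
    "inv \<phi> (bracket a b) = bracket (inv \<phi> a) (inv \<phi> b)" for a b c
    using inv(1)[of "inv \<phi> a + inv \<phi> b"] inv(1)[of "c *\<^sub>Q inv \<phi> a"]
      inv(1)[of "bracket (inv \<phi> a) (inv \<phi> b)"] \<phi>(1)
    by (simp_all add: rat_linearD[OF lin] lie_hom_def inv(2))
  then show ?thesis by (simp add: lie_hom_def rat_linearI)
qed

text \<open>Induction on terms: modulo [L,L] brackets vanish, and the other operations preserve
  multiples of the single generator.\<close>

lemma free_lie_one_generator:
  fixes u :: "'x free_lie"
  assumes one: "\<And>y :: 'x. y = x"
  shows "\<exists>c. u - c *\<^sub>Q free_gen x \<in> lower_central 2"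
proof -
  have "\<exists>c. abs_free_lie s - c *\<^sub>Q free_gen x \<in> lower_central 2" for s
  proof (induction s)
    case (Gen y)
    show ?case
      by (rule exI[of _ 1]) (simp add: one[of y] free_gen.abs_eq scaleQ_one lower_central_zero)
  next
    case Zero
    show ?case by (rule exI[of _ 0]) (simp add: lower_central_zero flip: zero_free_lie_def)
  next
    case (Neg s)
    then obtain c where "abs_free_lie s - c *\<^sub>Q free_gen x \<in> lower_central 2" by blast
    from lower_central_neg[OF this] show ?case
      by (intro exI[of _ "- c"]) (simp flip: uminus_free_lie.abs_eq)
  next
    case (Add s t)
    then obtain c d where "abs_free_lie s - c *\<^sub>Q free_gen x \<in> lower_central 2"
      "abs_free_lie t - d *\<^sub>Q free_gen x \<in> lower_central 2" by blast
    from lower_central_add[OF this] show ?case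
      by (intro exI[of _ "c + d"])
        (simp add: scaleQ_add_left algebra_simps flip: plus_free_lie.abs_eq)
  next
    case (Scale a s)
    then obtain c where "abs_free_lie s - c *\<^sub>Q free_gen x \<in> lower_central 2" by blast
    from lower_central_scale[OF this, of a] show ?case
      by (intro exI[of _ "a * c"])
        (simp add: rat_vector.scale_right_diff_distrib flip: scaleQ_free_lie.abs_eq)
  next
    case (Bracket s t)
    show ?case
      by (intro exI[of _ 0])
        (auto simp: numeral_2_eq_2 simp flip: bracket_free_lie.abs_eq intro: rat_vector.span_base)
  qed
  then show ?thesis by (metis Quotient_abs_rep[OF Quotient_free_lie])
qed

text \<open>With a single generator, its class would span the abelianization, so a basis could have
  at most one element.\<close>

lemma exists_two_generators:
  fixes \<phi> :: "'x free_lie \<Rightarrow> 'l::lie_algebra" and B :: "'l abelianization set"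
  assumes \<phi>: "lie_iso \<phi>" and B: "is_basis UNIV B" "infinite B \<or> card B > 1"
  shows "\<exists>x y :: 'x. x \<noteq> y"
proof (rule ccontr)
  assume "\<nexists>x y :: 'x. x \<noteq> y"
  then have one: "y = x" for x y :: 'x by blast
  \<comment> \<open>Types are inhabited, so at least one generator exists.\<close>
  fix x :: 'x
  have hom: "lie_hom \<phi>" and "bij \<phi>" using \<phi> by (simp_all add: lie_iso_def)
  then have lin: "rat_linear \<phi>" by (simp add: lie_hom_def)
  let ?v = "abs_abelianization (\<phi> (free_gen x))"
  have "v \<in> rat_vector.span {?v}" for v
  proof -
    obtain u where v: "v = abs_abelianization (\<phi> u)"
      using \<open>bij \<phi>\<close> Quotient_abs_rep[OF Quotient_abelianization] by (metis bij_pointE)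
    obtain c where "u - c *\<^sub>Q free_gen x \<in> lower_central 2"
      using free_lie_one_generator[of x u] one by blast
    from lie_hom_lower_central[OF hom this] have "v = abs_abelianization (c *\<^sub>Q \<phi> (free_gen x))"
      by (simp add: v abelianization.abs_eq_iff abelianization_rel_def rat_linearD[OF lin])
    then have "v = c *\<^sub>Q ?v" by (simp add: scaleQ_abelianization.abs_eq)
    then show ?thesis by (simp add: rat_vector.span_base rat_vector.span_scale)
  qed
  then have "B \<subseteq> rat_vector.span {?v}" by blast
  with B(1) have "finite B \<and> card B \<le> card {?v}"
    by (intro rat_vector.independent_span_bound) (simp_all add: is_basis_def)
  with B(2) show False by auto
qed

theorem theorem1:
  fixes \<phi> :: "'x free_lie \<Rightarrow> 'l::lie_algebra"
  assumes free: "lie_iso \<phi>"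
    and rank: "\<exists>B :: 'l abelianization set. is_basis UNIV B \<and> (infinite B \<or> card B > 1)"
  shows "\<exists>B :: 'l completion ce_homology set. is_basis (ce_homology_degree 2) B \<and> uncountable B"
proof -
  obtain x y :: 'x where "x \<noteq> y" using exists_two_generators[OF free] rank by blast
  \<comment> \<open>By freeness all values are admissible: \<open>x\<close> goes to the generator of
    Q and every other generator, in particular \<open>y\<close>, to 1 in Q[[t]].\<close>
  obtain h :: "'x free_lie \<Rightarrow> semidirect" where h: "lie_hom h"
    "\<And>z. h (free_gen z) = (if z = x then Semidirect 0 1 else Semidirect 1 0)"
    using free_lie_universal[of "\<lambda>z. if z = x then Semidirect 0 1 else Semidirect 1 0"] by blast
  have inv: "inv \<phi> (\<phi> a) = a" for a
    using free by (simp add: lie_iso_def bij_is_inj)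
  have "lie_hom (h \<circ> inv \<phi>)"
    using h(1) lie_hom_inv[OF free] by (auto simp: lie_hom_def rat_linearD intro!: rat_linearI)
  moreover have "(h \<circ> inv \<phi>) (\<phi> (free_gen x)) = Semidirect 0 1"
    "(h \<circ> inv \<phi>) (\<phi> (free_gen y)) = Semidirect 1 0"
    using \<open>x \<noteq> y\<close> by (simp_all add: inv h(2))
  ultimately have "uncountable (ce_homology_degree 2 :: 'l completion ce_homology set)"
    by (rule uncountable_ce_homology_degree_2)
  then show ?thesis
    by (rule uncountable_basis_if_uncountable[OF subspace_ce_homology_degree])
qed

end
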